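(* For every $n\ge1$ there exist bijections $\phi_n:\mathcal{D}_n\to NC_n$ and $\psi_n:\mathcal{D}_n\to\operatorname{Sort}_n$ such that for all $D\in\mathcal{D}_n$, $$\operatorname{area}(D)=\operatorname{inv}(\phi_n(D))=\operatorname{inv}(\psi_n(D)),$$ $$n(n-1)-\operatorname{maj}(D)=\operatorname{maj}(\phi_n(D))+\operatorname{imaj}(\phi_n(D))=\operatorname{maj}(\psi_n(D))+\operatorname{imaj}(\psi_n(D)).$$
   Context: $\mathcal{S}_n$ is the set of permutations of $\{1,\dots,n\}$, written in one-line notation $\sigma=[\sigma_1,\dots,\sigma_n]$. A set partition of a totally ordered finite set is noncrossing if there are no elements $a<b<c<d$ with $a,c$ in one block and $b,d$ in another block. $NC_n\subseteq\mathcal{S}_n$ is the set of permutations obtained from noncrossing set partitions $P$ of $\{1,\dots,n\}$ by sending $P$ to the permutation whose cycles are the blocks of $P$ written in increasing order (the block $\{i_1<\dots<i_k\}$ becomes the cycle $(i_1,\dots,i_k)$). $\operatorname{Sort}_n\subseteq\mathcal{S}_n$ is the set of $231$-avoiding permutations: those $\sigma$ for which there are no $a<b<c$ with $\sigma_c<\sigma_a<\sigma_b$. For $\sigma\in\mathcal{S}_n$: $\operatorname{Des}(\sigma)=\{1\le i<n:\sigma_i>\sigma_{i+1}\}$, $\operatorname{maj}(\sigma)=\sum_{i\in\operatorname{Des}(\sigma)}i$, $\operatorname{imaj}(\sigma)=\operatorname{maj}(\sigma^{-1})$, $\operatorname{inv}(\sigma)=|\{1\le i<j\le n:\sigma_i>\sigma_j\}|$.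 $\mathcal{D}_n$ is the set of Dyck paths of length $2n$: lattice paths in $\mathbb{Z}^2$ starting at $(0,0)$, consisting of $n$ north steps and $n$ east steps, and never going below the diagonal $x=y$. For $D\in\mathcal{D}_n$, $\operatorname{Des}(D)$ is the set of indices $i$ such that the $i$-th step of $D$ is an east step and the $(i+1)$-st step is a north step, and $\operatorname{maj}(D)=\sum_{i\in\operatorname{Des}(D)}i$. The statistic $\operatorname{area}(D)$ is the number of open unit boxes $b_{ij}=\{(x,y)\in\mathbb{R}^2:i<x<i+1,\ j<y<j+1\}$ ($i,j\in\mathbb{Z}$) which lie below $D$ and strictly above the diagonal $x=y$ (that is, $i<j$). *)

theory Defs
  imports "HOL-Analysis.Analysis" "HOL-Combinatorics.Combinatorics"
begin

text \<open>
  A permutation of \<open>{1..n}\<close> is a function \<open>\<sigma> :: nat \<Rightarrow> nat\<close> with \<open>\<sigma> permutes {1..n}\<close>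
  (so it is the identity outside \<open>{1..n}\<close>); its one-line notation is \<open>[\<sigma> 1, \<dots>, \<sigma> n]\<close>.
\<close>

subsection \<open>Statistics on permutations\<close>

definition perm_Des :: "nat \<Rightarrow> (nat \<Rightarrow> nat) \<Rightarrow> nat set" where
  "perm_Des n \<sigma> = {i. 1 \<le> i \<and> i < n \<and> \<sigma> i > \<sigma> (i + 1)}"

definition perm_maj :: "nat \<Rightarrow> (nat \<Rightarrow> nat) \<Rightarrow> nat" where
  "perm_maj n \<sigma> = (\<Sum>i\<in>perm_Des n \<sigma>. i)"

definition perm_imaj :: "nat \<Rightarrow> (nat \<Rightarrow> nat) \<Rightarrow> nat" where
  "perm_imaj n \<sigma> = perm_maj n (inv \<sigma>)"

definition perm_inv :: "nat \<Rightarrow> (nat \<Rightarrow> nat) \<Rightarrow> nat" where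
  "perm_inv n \<sigma> = card {(i, j). 1 \<le> i \<and> i < j \<and> j \<le> n \<and> \<sigma> i > \<sigma> j}"

subsection \<open>Noncrossing and 231-avoiding permutations\<close>

definition noncrossing :: "'a::linorder set set \<Rightarrow> bool" where
  "noncrossing P \<longleftrightarrow>
     \<not> (\<exists>a b c d. \<exists>A\<in>P. \<exists>B\<in>P. A \<noteq> B \<and> a < b \<and> b < c \<and> c < d \<and>
          a \<in> A \<and> c \<in> A \<and> b \<in> B \<and> d \<in> B)"

text \<open>
  \<open>cycle_of_list [i\<^sub>1, \<dots>, i\<^sub>k]\<close> is the cycle sending \<open>i\<^sub>1\<close> to \<open>i\<^sub>2\<close>, \<dots>, and \<open>i\<^sub>k\<close> to \<open>i\<^sub>1\<close>.
\<close>

definition perm_of_partition :: "nat set set \<Rightarrow> nat \<Rightarrow> nat" where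
  "perm_of_partition P x =
     (if x \<in> \<Union>P then cycle_of_list (sorted_list_of_set (THE B. B \<in> P \<and> x \<in> B)) x else x)"

definition NC :: "nat \<Rightarrow> (nat \<Rightarrow> nat) set" where
  "NC n = perm_of_partition ` {P. partition_on {1..n} P \<and> noncrossing P}"

definition Sort :: "nat \<Rightarrow> (nat \<Rightarrow> nat) set" where
  "Sort n = {\<sigma>. \<sigma> permutes {1..n} \<and>
     \<not> (\<exists>a b c. 1 \<le> a \<and> a < b \<and> b < c \<and> c \<le> n \<and> \<sigma> c < \<sigma> a \<and> \<sigma> a < \<sigma> b)}"

subsection \<open>Dyck paths\<close>

datatype step = North | East

definition vertex :: "step list \<Rightarrow> nat \<Rightarrow> real \<times> real" where
  "vertex D k = (real (count_list (take k D) East), real (count_list (take k D) North))"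

definition path_curve :: "step list \<Rightarrow> (real \<times> real) set" where
  "path_curve D = (\<Union>k<length D. closed_segment (vertex D k) (vertex D (Suc k)))"

text \<open>A path stays weakly above the diagonal iff all of its lattice points do.\<close>

definition Dyck :: "nat \<Rightarrow> step list set" where
  "Dyck n = {D. count_list D North = n \<and> count_list D East = n \<and>
     (\<forall>k\<le>length D. fst (vertex D k) \<le> snd (vertex D k))}"

text \<open>Steps are numbered from 1, so the \<open>i\<close>-th step of \<open>D\<close> is \<open>D ! (i - 1)\<close>.\<close>

definition path_Des :: "step list \<Rightarrow> nat set" where
  "path_Des D = {i. 1 \<le> i \<and> i < length D \<and> D ! (i - 1) = East \<and> D ! i = North}"

definition path_maj :: "step list \<Rightarrow> nat" where
  "path_maj D = (\<Sum>i\<in>path_Des D. i)"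

definition unit_box :: "int \<Rightarrow> int \<Rightarrow> (real \<times> real) set" where
  "unit_box i j = {(x, y). real_of_int i < x \<and> x < real_of_int i + 1 \<and>
                           real_of_int j < y \<and> y < real_of_int j + 1}"

definition lies_below :: "(real \<times> real) set \<Rightarrow> step list \<Rightarrow> bool" where
  "lies_below S D \<longleftrightarrow> (\<forall>(x, y)\<in>S. \<exists>y'. y < y' \<and> (x, y') \<in> path_curve D)"

definition area :: "step list \<Rightarrow> nat" where
  "area D = card {(i, j). lies_below (unit_box i j) D \<and> i < j}"

end

theory Submission
  imports Defs
begin

text \<open>
  All three families obey the same Catalan recursion, so all three are indexed by binary trees, and
  \<open>\<phi>\<close> and \<open>\<psi>\<close> read off the tree of a path and rebuild a permutation from it. A path is uniquely
  \<open>x N y E\<close> with shorter paths \<open>x\<close> and \<open>y\<close>. A 231-avoiding permutation is uniquely a direct sum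
  \<open>x \<oplus> c(y)\<close>, where \<open>c(y)\<close> puts a new maximum in front of \<open>y\<close>. A noncrossing permutation is
  uniquely \<open>x \<oplus> c(y)\<^sup>-\<^sup>1\<close>; here \<open>x\<close> ends before the least element of the block of the last point,
  and passing from \<open>y\<close> to \<open>c(y)\<^sup>-\<^sup>1\<close> is a form of the Kreweras complement.

  Why the statistics agree: let \<open>y\<close> have size \<open>m\<close>. Lifting a path to \<open>N y E\<close> adds \<open>m\<close> to the area
  and shifts all its valleys by one. Correspondingly \<open>c(y)\<close> has \<open>m\<close> more inversions than \<open>y\<close>, the
  ascents of \<open>c(y)\<close> are those of \<open>y\<close> shifted by one, and the ascents of its inverse are those of
  the inverse of \<open>y\<close>. A direct sum adds inversions and, at the seam, creates one ascent of the
  permutation and one of its inverse, as the concatenation of two paths creates one valley, whose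
  position is twice the position of the seam. Hence \<open>area\<close> is \<open>inv\<close>, and \<open>maj\<close> of the path is the
  sum of all ascents of the permutation and of its inverse. Since the ascents and the descents of a
  permutation together exhaust \<open>{1..n - 1}\<close>, this sum is \<open>n (n - 1) - maj - imaj\<close>.

  Both \<open>inv\<close> and the sum of the ascents of a permutation and of its inverse do not change under taking
  inverses, so replacing \<open>c(y)\<close> by its inverse changes nothing (\<open>realises_Node\<close>, \<open>realises_Node_inv\<close>). What
  distinguishes the two families is only which set is closed under the recursion. For noncrossing
  permutations this rests on a description by two closure conditions on intervals (\<open>NC_eq\<close>) which
  the map \<open>y \<mapsto> c(y)\<^sup>-\<^sup>1\<close> interchanges (\<open>inv_cons_max_noncrossing_perm_iff\<close>).
\<close>

section \<open>The Catalan recursion\<close>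

datatype shape = Leaf | Node shape shape

fun build :: "'a \<Rightarrow> (nat \<Rightarrow> nat \<Rightarrow> 'a \<Rightarrow> 'a \<Rightarrow> 'a) \<Rightarrow> shape \<Rightarrow> 'a" where
  "build e c Leaf = e"
| "build e c (Node l r) = c (size l) (size r) (build e c l) (build e c r)"

text \<open>
  A graded family of sets that starts with one object and in which every later object is, in
  exactly one way, a combination of two smaller ones is a copy of the binary trees.
\<close>

lemma bij_betw_build:
  fixes F :: "nat \<Rightarrow> 'a set"
  assumes zero: "F 0 = {e}"
    and closed: "\<And>k m x y. x \<in> F k \<Longrightarrow> y \<in> F m \<Longrightarrow> c k m x y \<in> F (Suc (k + m))"
    and split: "\<And>n z. z \<in> F (Suc n) \<Longrightarrow>
      \<exists>k m x y. k + m = n \<and> x \<in> F k \<and> y \<in> F m \<and> z = c k m x y"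
    and unique: "\<And>k m x y k' m' x' y'. \<lbrakk>x \<in> F k; y \<in> F m; x' \<in> F k'; y' \<in> F m';
      k + m = k' + m'; c k m x y = c k' m' x' y'\<rbrakk> \<Longrightarrow> k = k' \<and> x = x' \<and> y = y'"
  shows "bij_betw (build e c) {t. size t = n} (F n)"
proof -
  have mem: "build e c t \<in> F (size t)" for t
    by (induction t) (use zero closed in \<open>auto simp: add.commute\<close>)
  have inj: "size t = size t' \<Longrightarrow> build e c t = build e c t' \<Longrightarrow> t = t'" for t t'
  proof (induction t arbitrary: t')
    case Leaf
    then show ?case by (cases t') auto
  next
    case (Node l r)
    then obtain l' r' where t': "t' = Node l' r'" by (cases t') auto
    have sizes: "size l + size r = size l' + size r'" using Node.prems(1) t' by simp
    have "size l = size l' \<and> build e c l = build e c l' \<and> build e c r = build e c r'"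
      by (rule unique[OF mem mem mem mem sizes]) (use Node.prems(2) t' in simp)
    with Node.IH(1)[of l'] Node.IH(2)[of r'] t' sizes show ?case by simp
  qed
  have surj: "z \<in> F n \<Longrightarrow> \<exists>t. size t = n \<and> build e c t = z" for n z
  proof (induction n arbitrary: z rule: less_induct)
    case (less n)
    show ?case
    proof (cases n)
      case 0
      then show ?thesis using less.prems zero by (intro exI[of _ Leaf]) auto
    next
      case (Suc n')
      with split less.prems obtain k m x y where
        s: "k + m = n'" "x \<in> F k" "y \<in> F m" "z = c k m x y" by blast
      have "k < n" "m < n" using s(1) Suc by auto
      then obtain l r where "size l = k" "build e c l = x" "size r = m" "build e c r = y"
        using less.IH s by metis
      then show ?thesis using s Suc by (intro exI[of _ "Node l r"]) auto
    qed
  qed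
  show ?thesis
    unfolding bij_betw_def
  proof (intro conjI inj_onI subset_antisym subsetI)
    fix z assume "z \<in> F n"
    then obtain t where "size t = n" "build e c t = z" using surj by blast
    then show "z \<in> build e c ` {t. size t = n}" by auto
  qed (use mem inj in auto)
qed

text \<open>
  The joint statistics of the three families, as functions of the tree: \<open>shape_area\<close> is the area
  of the path and the number of inversions, \<open>shape_val\<close> the number of valleys of the path and the
  number of ascents of the permutation as well as of its inverse, and \<open>shape_maj\<close> the sum of the
  valley positions and the sum of all these ascents.
\<close>

fun shape_area :: "shape \<Rightarrow> nat" where
  "shape_area Leaf = 0"
| "shape_area (Node l r) = shape_area l + shape_area r + size r"

fun shape_val :: "shape \<Rightarrow> nat" where
  "shape_val Leaf = 0"
| "shape_val (Node l r) = shape_val l + (if l = Leaf then 0 else 1) + shape_val r"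

fun shape_maj :: "shape \<Rightarrow> nat" where
  "shape_maj Leaf = 0"
| "shape_maj (Node l r) = shape_maj l + (if l = Leaf then 0 else 2 * size l)
     + shape_maj r + (2 * size l + 1) * shape_val r"

section \<open>Direct sums and prefixing the maximum\<close>

definition dirsum :: "nat \<Rightarrow> (nat \<Rightarrow> nat) \<Rightarrow> (nat \<Rightarrow> nat) \<Rightarrow> nat \<Rightarrow> nat" where
  "dirsum k x y i = (if i \<le> k then x i else k + y (i - k))"

definition cons_max :: "nat \<Rightarrow> (nat \<Rightarrow> nat) \<Rightarrow> nat \<Rightarrow> nat" where
  "cons_max m y i = (if i = 0 \<or> Suc m < i then i else if i = 1 then Suc m else y (i - 1))"

lemma permutes_ivl_in: "x permutes {1..k::nat} \<Longrightarrow> 1 \<le> i \<Longrightarrow> i \<le> k \<Longrightarrow> 1 \<le> x i \<and> x i \<le> k"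
  using permutes_in_image[of x "{1..k}" i] by auto

lemma permutes_ivl_out: "x permutes {1..k::nat} \<Longrightarrow> i = 0 \<or> k < i \<Longrightarrow> x i = i"
  by (auto intro: permutes_not_in)

lemma permutes_ivl_le: "x permutes {1..k::nat} \<Longrightarrow> i \<le> k \<Longrightarrow> x i \<le> k"
  using permutes_ivl_in[of x k i] permutes_ivl_out[of x k i] by (cases "i = 0") auto

lemma permutes_ivl_pos: "x permutes {1..k::nat} \<Longrightarrow> 1 \<le> i \<Longrightarrow> 1 \<le> x i"
  using permutes_ivl_in[of x k i] permutes_ivl_out[of x k i] by (cases "i \<le> k") auto

lemma permutes_inv_unique:
  assumes "\<And>i. i \<notin> S \<Longrightarrow> p i = i" "\<And>i. q (p i) = i" "\<And>i. p (q i) = i"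
  shows "p permutes S" "inv p = q"
proof -
  show "p permutes S" unfolding permutes_def using assms by metis
  show "inv p = q" using assms by (intro inv_equality) auto
qed

lemma
  assumes x: "x permutes {1..k}" and y: "y permutes {1..m}"
  shows dirsum_permutes: "dirsum k x y permutes {1..k + m}"
    and inv_dirsum: "inv (dirsum k x y) = dirsum k (inv x) (inv y)"
proof -
  have *: "dirsum k (inv a) (inv b) (dirsum k a b i) = i"
    if a: "a permutes {1..k}" and b: "b permutes {1..m}" for a b i
  proof (cases "i \<le> k")
    case True
    then show ?thesis
      using permutes_ivl_le[OF a] permutes_inverses(2)[OF a] by (simp add: dirsum_def)
  next
    case False
    then have "1 \<le> b (i - k)" by (intro permutes_ivl_pos[OF b]) simp
    with False show ?thesis using permutes_inverses(2)[OF b] by (simp add: dirsum_def)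
  qed
  have **: "dirsum k x y (dirsum k (inv x) (inv y) i) = i" for i
    using *[OF permutes_inv[OF x] permutes_inv[OF y], of i]
    by (simp add: permutes_inv_inv[OF x] permutes_inv_inv[OF y])
  have out: "dirsum k x y i = i" if "i \<notin> {1..k + m}" for i
    using that permutes_ivl_out[OF x, of i] permutes_ivl_out[OF y, of "i - k"]
    by (auto simp: dirsum_def)
  show "dirsum k x y permutes {1..k + m}" "inv (dirsum k x y) = dirsum k (inv x) (inv y)"
    using permutes_inv_unique[OF out *[OF x y] **] by blast+
qed

lemma
  assumes y: "y permutes {1..m}"
  shows cons_max_permutes: "cons_max m y permutes {1..Suc m}"
    and inv_cons_max: "inv (cons_max m y) =
      (\<lambda>i. if i = 0 \<or> Suc m < i then i else if i = Suc m then 1 else Suc (inv y i))"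
      (is "_ = ?q")
proof -
  have y': "inv y permutes {1..m}" using y by (rule permutes_inv)
  have 1: "?q (cons_max m y i) = i" for i
  proof (cases "2 \<le> i \<and> i \<le> Suc m")
    case True
    then have "1 \<le> y (i - 1) \<and> y (i - 1) \<le> m" by (intro permutes_ivl_in[OF y]) auto
    with True show ?thesis by (simp add: cons_max_def permutes_inverses[OF y])
  next
    case False
    then have "i = 0 \<or> i = 1 \<or> Suc m < i" by auto
    then show ?thesis by (auto simp: cons_max_def)
  qed
  have 2: "cons_max m y (?q i) = i" for i
  proof (cases "1 \<le> i \<and> i \<le> m")
    case True
    then have "1 \<le> inv y i \<and> inv y i \<le> m" by (intro permutes_ivl_in[OF y']) auto
    with True show ?thesis by (simp add: cons_max_def permutes_inverses[OF y])
  next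
    case False
    then have "i = 0 \<or> i = Suc m \<or> Suc m < i" by auto
    then show ?thesis by (auto simp: cons_max_def)
  qed
  have out: "cons_max m y i = i" if "i \<notin> {1..Suc m}" for i
    using that by (auto simp: cons_max_def)
  show "cons_max m y permutes {1..Suc m}" "inv (cons_max m y) = ?q"
    using permutes_inv_unique[OF out 1 2] by blast+
qed

lemma dirsum_inject:
  assumes "x permutes {1..k}" "y permutes {1..m}" "x' permutes {1..k}" "y' permutes {1..m'}"
    and eq: "dirsum k x y = dirsum k x' y'"
  shows "x = x' \<and> y = y'"
proof -
  have "x i = x' i" for i
    using fun_cong[OF eq, of i] permutes_ivl_out[OF assms(1), of i]
      permutes_ivl_out[OF assms(3), of i]
    by (cases "i \<le> k") (auto simp: dirsum_def)
  moreover have "y i = y' i" for i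
    using fun_cong[OF eq, of "k + i"] permutes_ivl_out[OF assms(2), of i]
      permutes_ivl_out[OF assms(4), of i]
    by (cases "i = 0") (auto simp: dirsum_def)
  ultimately show ?thesis by auto
qed

lemma cons_max_inject:
  assumes "y permutes {1..m}" "y' permutes {1..m}" and eq: "cons_max m y = cons_max m y'"
  shows "y = y'"
proof
  fix i
  show "y i = y' i"
    using fun_cong[OF eq, of "Suc i"] permutes_ivl_out[OF assms(1), of i]
      permutes_ivl_out[OF assms(2), of i]
    by (cases "i = 0 \<or> m < i") (auto simp: cons_max_def)
qed

text \<open>A permutation that maps an initial segment into itself is a direct sum.\<close>

lemma dirsum_split:
  assumes z: "z permutes {1..k + m}" and pre: "\<And>i. 1 \<le> i \<Longrightarrow> i \<le> k \<Longrightarrow> z i \<le> k"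
  shows "\<exists>x y. x permutes {1..k} \<and> y permutes {1..m} \<and> z = dirsum k x y"
proof -
  define x where "x i = (if i \<le> k then z i else i)" for i
  define y where "y i = z (k + i) - k" for i
  note [simp] = inj_eq[OF permutes_inj[OF z]]
  have z0: "z 0 = 0" using permutes_ivl_out[OF z] by simp
  have zpos: "1 \<le> z i" if "1 \<le> i" for i using permutes_ivl_pos[OF z that] .
  have image: "z ` {1..k} = {1..k}"
  proof (rule endo_inj_surj)
    show "z ` {1..k} \<subseteq> {1..k}" using pre zpos by auto
    show "inj_on z {1..k}" using z by (rule permutes_inj_on)
  qed simp
  have above: "k < z i" if "k < i" for i
  proof (rule ccontr)
    assume "\<not> k < z i"
    then have "z i \<in> z ` {1..k}" using image zpos[of i] that by simp
    then show False using that by auto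
  qed
  have "x permutes {1..k}"
  proof (rule inj_imp_permutes)
    show "inj_on x {1..k}" by (auto simp: inj_on_def x_def)
    show "x i = i" if "i \<notin> {1..k}" for i using that z0 by (cases "i = 0") (auto simp: x_def)
  qed (use pre zpos in \<open>auto simp: x_def\<close>)
  moreover have "y permutes {1..m}"
  proof (rule inj_imp_permutes)
    show "inj_on y {1..m}"
    proof (rule inj_onI)
      fix i j assume "i \<in> {1..m}" "j \<in> {1..m}" "y i = y j"
      moreover from this have "k < z (k + i)" "k < z (k + j)" using above by auto
      ultimately have "z (k + i) = z (k + j)" unfolding y_def by linarith
      then show "i = j" by simp
    qed
    show "y i \<in> {1..m}" if "i \<in> {1..m}" for i
      using that above[of "k + i"] permutes_ivl_in[OF z, of "k + i"] by (auto simp: y_def)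
    show "y i = i" if "i \<notin> {1..m}" for i
      using that permutes_ivl_out[OF z, of "k + i"] pre[of k] z0
      by (cases "i = 0"; cases "k = 0") (auto simp: y_def)
  qed simp
  moreover have "z = dirsum k x y"
  proof
    fix i
    show "z i = dirsum k x y i" using above[of i] by (auto simp: dirsum_def x_def y_def)
  qed
  ultimately show ?thesis by blast
qed

lemma cons_max_split:
  assumes z: "z permutes {1..Suc m}" and z1: "z 1 = Suc m"
  shows "\<exists>y. y permutes {1..m} \<and> z = cons_max m y"
proof -
  define y where "y i = (if 1 \<le> i \<and> i \<le> m then z (Suc i) else i)" for i
  note [simp] = inj_eq[OF permutes_inj[OF z]]
  have le: "z (Suc i) \<le> m" if "1 \<le> i" "i \<le> m" for i
  proof -
    have "z (Suc i) \<noteq> z 1" using that by simp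
    then have "z (Suc i) \<noteq> Suc m" unfolding z1 .
    then show ?thesis using permutes_ivl_in[OF z, of "Suc i"] that z1 by auto
  qed
  have "y permutes {1..m}"
  proof (rule inj_imp_permutes)
    show "inj_on y {1..m}" by (auto simp: inj_on_def y_def)
    show "y i \<in> {1..m}" if "i \<in> {1..m}" for i
      using that le permutes_ivl_in[OF z, of "Suc i"] by (auto simp: y_def)
  qed (auto simp: y_def)
  moreover have "z = cons_max m y"
  proof
    fix i
    show "z i = cons_max m y i"
      using z1 permutes_ivl_out[OF z, of i]
      by (cases "i = 0 \<or> Suc m < i"; cases "i = 1") (auto simp: cons_max_def y_def)
  qed
  ultimately show ?thesis by blast
qed

section \<open>Inversions and ascents\<close>

text \<open>
  Ascents rather than descents match the valleys of a path: concatenating two paths creates a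
  valley, and a direct sum of two permutations creates an ascent.
\<close>

definition Asc :: "nat \<Rightarrow> (nat \<Rightarrow> nat) \<Rightarrow> nat set" where
  "Asc n x = {i. 1 \<le> i \<and> i < n \<and> x i < x (Suc i)}"

lemma finite_Asc [simp]: "finite (Asc n x)"
  by (rule finite_subset[of _ "{..n}"]) (auto simp: Asc_def)

lemma perm_maj_plus_Asc:
  assumes x: "x permutes {1..n}"
  shows "2 * (perm_maj n x + \<Sum>(Asc n x)) = n * (n - 1)"
proof -
  have un: "perm_Des n x \<union> Asc n x = {..<n} - {0}"
  proof (intro subset_antisym subsetI)
    fix i assume "i \<in> {..<n} - {0}"
    moreover have "x i \<noteq> x (Suc i)" by (simp add: inj_eq[OF permutes_inj[OF x]])
    ultimately show "i \<in> perm_Des n x \<union> Asc n x" by (auto simp: perm_Des_def Asc_def)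
  qed (auto simp: perm_Des_def Asc_def)
  have "perm_maj n x + \<Sum>(Asc n x) = \<Sum>(perm_Des n x \<union> Asc n x)"
    unfolding perm_maj_def
  proof (rule sum.union_disjoint[symmetric])
    show "finite (perm_Des n x)" by (rule finite_subset[of _ "{..n}"]) (auto simp: perm_Des_def)
  qed (auto simp: perm_Des_def Asc_def)
  also have "\<dots> = \<Sum>{..<n}" unfolding un by (rule sum.mono_neutral_left) auto
  also have "2 * \<dots> = n * (n - 1)" by (induction n) (auto simp: algebra_simps)
  finally show ?thesis .
qed

lemma finite_inversions: "finite {(i, j). 1 \<le> i \<and> i < j \<and> j \<le> (n :: nat) \<and> (x i :: nat) > x j}"
  by (rule finite_subset[of _ "{..n::nat} \<times> {..n}"]) auto

lemma perm_inv_inv: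
  assumes x: "x permutes {1..n::nat}"
  shows "perm_inv n (inv x) = perm_inv n x"
proof -
  have "bij_betw (\<lambda>(i, j). (x j, x i)) {(i, j). 1 \<le> i \<and> i < j \<and> j \<le> n \<and> x i > x j}
          {(i, j). 1 \<le> i \<and> i < j \<and> j \<le> n \<and> inv x i > inv x j}"
  proof (rule bij_betw_byWitness[where f' = "\<lambda>(i, j). (inv x j, inv x i)"])
    have "1 \<le> x j \<and> x i \<le> n" if "1 \<le> i" "i < j" "j \<le> n" for i j
      using that permutes_ivl_pos[OF x, of j] permutes_ivl_le[OF x, of i] by simp
    then show "(\<lambda>(i, j). (x j, x i)) ` {(i, j). 1 \<le> i \<and> i < j \<and> j \<le> n \<and> x i > x j}
        \<subseteq> {(i, j). 1 \<le> i \<and> i < j \<and> j \<le> n \<and> inv x i > inv x j}"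
      by (auto simp: permutes_inverses[OF x])
    have "1 \<le> inv x j \<and> inv x i \<le> n" if "1 \<le> i" "i < j" "j \<le> n" for i j
      using that permutes_ivl_pos[OF permutes_inv[OF x], of j]
        permutes_ivl_le[OF permutes_inv[OF x], of i] by simp
    then show "(\<lambda>(i, j). (inv x j, inv x i)) `
          {(i, j). 1 \<le> i \<and> i < j \<and> j \<le> n \<and> inv x i > inv x j}
        \<subseteq> {(i, j). 1 \<le> i \<and> i < j \<and> j \<le> n \<and> x i > x j}"
      by (auto simp: permutes_inverses[OF x])
  qed (auto simp: permutes_inverses[OF x])
  then show ?thesis unfolding perm_inv_def by (rule bij_betw_same_card[symmetric])
qed

lemma perm_inv_dirsum:
  assumes x: "x permutes {1..k}" and y: "y permutes {1..m}"
  shows "perm_inv (k + m) (dirsum k x y) = perm_inv k x + perm_inv m y"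
proof -
  let ?X = "{(i, j). 1 \<le> i \<and> i < j \<and> j \<le> k \<and> x i > x j}"
  let ?Y = "{(i, j). 1 \<le> i \<and> i < j \<and> j \<le> m \<and> y i > y j}"
  let ?s = "\<lambda>(i, j). (k + i, k + j)"
  have "{(i, j). 1 \<le> i \<and> i < j \<and> j \<le> k + m \<and> dirsum k x y i > dirsum k x y j} = ?X \<union> ?s ` ?Y"
    (is "?L = ?R")
  proof (intro subset_antisym subsetI)
    fix p assume "p \<in> ?L"
    then obtain i j where p: "p = (i, j)" and
      ij: "1 \<le> i" "i < j" "j \<le> k + m" "dirsum k x y i > dirsum k x y j" by auto
    consider "j \<le> k" | "i \<le> k" "k < j" | "k < i" by linarith
    then show "p \<in> ?R"
    proof cases
      case 1
      then show ?thesis using p ij by (auto simp: dirsum_def)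
    next
      case 2
      then show ?thesis using ij permutes_ivl_le[OF x, of i] by (auto simp: dirsum_def)
    next
      case 3
      then have "p = ?s (i - k, j - k) \<and> (i - k, j - k) \<in> ?Y" using p ij by (auto simp: dirsum_def)
      then show ?thesis by blast
    qed
  next
    fix p assume "p \<in> ?R"
    then show "p \<in> ?L" by (auto simp: dirsum_def)
  qed
  moreover have "card (?X \<union> ?s ` ?Y) = card ?X + card (?s ` ?Y)"
    by (intro card_Un_disjoint finite_imageI finite_inversions) auto
  moreover have "card (?s ` ?Y) = card ?Y" by (rule card_image) (auto simp: inj_on_def)
  ultimately show ?thesis by (simp add: perm_inv_def)
qed

lemma perm_inv_cons_max:
  assumes y: "y permutes {1..m}"
  shows "perm_inv (Suc m) (cons_max m y) = perm_inv m y + m"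
proof -
  let ?Y = "{(i, j). 1 \<le> i \<and> i < j \<and> j \<le> m \<and> y i > y j}"
  let ?s = "\<lambda>(i, j). (Suc i, Suc j)"
  let ?c = "cons_max m y"
  have "{(i, j). 1 \<le> i \<and> i < j \<and> j \<le> Suc m \<and> ?c i > ?c j} = ?s ` ?Y \<union> {1} \<times> {2..Suc m}"
    (is "?L = ?R")
  proof (intro subset_antisym subsetI)
    fix p assume "p \<in> ?L"
    then obtain i j where p: "p = (i, j)" and
      ij: "1 \<le> i" "i < j" "j \<le> Suc m" "?c i > ?c j" by auto
    show "p \<in> ?R"
    proof (cases "i = 1")
      case False
      then have "p = ?s (i - 1, j - 1) \<and> (i - 1, j - 1) \<in> ?Y" using p ij
        by (auto simp: cons_max_def split: if_splits)
      then show ?thesis by blast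
    qed (use p ij in auto)
  next
    fix p assume p: "p \<in> ?R"
    have "y (j - 1) \<le> m" if "2 \<le> j" "j \<le> Suc m" for j
      using that by (intro permutes_ivl_le[OF y]) auto
    then show "p \<in> ?L" using p by (force simp: cons_max_def)
  qed
  moreover have "card (?s ` ?Y \<union> {1} \<times> {2..Suc m}) = card (?s ` ?Y) + card ({1::nat} \<times> {2..Suc m})"
    by (intro card_Un_disjoint finite_imageI finite_inversions) auto
  moreover have "card (?s ` ?Y) = card ?Y" by (rule card_image) (auto simp: inj_on_def)
  ultimately show ?thesis by (simp add: perm_inv_def)
qed

lemma Asc_dirsum:
  assumes x: "x permutes {1..k}" and y: "y permutes {1..m}" and m: "1 \<le> m"
  shows "Asc (k + m) (dirsum k x y) = Asc k x \<union> (if k = 0 then {} else {k}) \<union> (+) k ` Asc m y"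
    (is "?L = ?R")
proof (intro subset_antisym subsetI)
  fix i assume i: "i \<in> ?L"
  show "i \<in> ?R"
  proof (cases "i \<le> k")
    case True
    then show ?thesis using i by (cases "i = k") (auto simp: Asc_def dirsum_def)
  next
    case False
    then have "i = k + (i - k) \<and> i - k \<in> Asc m y" using i by (auto simp: Asc_def dirsum_def Suc_diff_le)
    then show ?thesis by blast
  qed
next
  fix i assume "i \<in> ?R"
  then consider "i \<in> Asc k x" | "i = k" "k \<noteq> 0" | j where "i = k + j" "j \<in> Asc m y"
    by (auto split: if_splits)
  then show "i \<in> ?L"
  proof cases
    case 2
    then show ?thesis using permutes_ivl_le[OF x, of k] permutes_ivl_pos[OF y, of 1] m
      by (auto simp: Asc_def dirsum_def)
  qed (use m in \<open>auto simp: Asc_def dirsum_def Suc_diff_le\<close>)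
qed

lemma
  assumes x: "x permutes {1..k}" and y: "y permutes {1..m}" and m: "1 \<le> m"
  shows card_Asc_dirsum: "card (Asc (k + m) (dirsum k x y))
      = card (Asc k x) + (if k = 0 then 0 else 1) + card (Asc m y)"
    and sum_Asc_dirsum: "\<Sum>(Asc (k + m) (dirsum k x y))
      = \<Sum>(Asc k x) + k + (\<Sum>(Asc m y) + k * card (Asc m y))"
proof -
  let ?K = "if k = 0 then {} else {k}"
  have disj: "(Asc k x \<union> ?K) \<inter> (+) k ` Asc m y = {}" "Asc k x \<inter> ?K = {}"
    by (auto simp: Asc_def)
  show "card (Asc (k + m) (dirsum k x y))
      = card (Asc k x) + (if k = 0 then 0 else 1) + card (Asc m y)"
    unfolding Asc_dirsum[OF assms] using disj
    by (simp add: card_Un_disjoint card_image)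
  have "\<Sum>((+) k ` Asc m y) = \<Sum>(Asc m y) + k * card (Asc m y)"
    by (subst sum.reindex) (auto simp: sum.distrib)
  then show "\<Sum>(Asc (k + m) (dirsum k x y))
      = \<Sum>(Asc k x) + k + (\<Sum>(Asc m y) + k * card (Asc m y))"
    unfolding Asc_dirsum[OF assms] using disj
    by (simp add: sum.union_disjoint)
qed

lemma Asc_cons_max:
  assumes y: "y permutes {1..m}"
  shows "Asc (Suc m) (cons_max m y) = Suc ` Asc m y"
proof (intro subset_antisym subsetI)
  fix i assume i: "i \<in> Asc (Suc m) (cons_max m y)"
  have "i \<noteq> 1" using i permutes_ivl_le[OF y, of 1] by (auto simp: Asc_def cons_max_def)
  with i have "i = Suc (i - 1) \<and> i - 1 \<in> Asc m y" by (auto simp: Asc_def cons_max_def)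
  then show "i \<in> Suc ` Asc m y" by blast
next
  fix i assume "i \<in> Suc ` Asc m y"
  then obtain j where "i = Suc j" "1 \<le> j" "j < m" "y j < y (Suc j)" by (auto simp: Asc_def)
  then show "i \<in> Asc (Suc m) (cons_max m y)" by (simp add: Asc_def cons_max_def)
qed

lemma Asc_inv_cons_max:
  assumes y: "y permutes {1..m}"
  shows "Asc (Suc m) (inv (cons_max m y)) = Asc m (inv y)"
  unfolding inv_cons_max[OF y] by (auto simp: Asc_def)

text \<open>
  Only the sum of the ascents of a permutation and of its inverse is recorded, so that the
  property passes from a permutation to its inverse. Shifting ascents to the right changes that
  sum by their number, which is why the two numbers of ascents are recorded as well.
\<close>

definition realises :: "shape \<Rightarrow> (nat \<Rightarrow> nat) \<Rightarrow> bool" where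
  "realises t x \<longleftrightarrow> x permutes {1..size t} \<and> perm_inv (size t) x = shape_area t \<and>
     card (Asc (size t) x) = shape_val t \<and> card (Asc (size t) (inv x)) = shape_val t \<and>
     \<Sum>(Asc (size t) x) + \<Sum>(Asc (size t) (inv x)) = shape_maj t"

lemma realises_inv: "realises t x \<Longrightarrow> realises t (inv x)"
  by (auto simp: realises_def permutes_inv permutes_inv_inv perm_inv_inv)

lemma realises_Leaf: "realises Leaf id"
proof -
  have "{(i, j). 1 \<le> i \<and> i < j \<and> j \<le> 0 \<and> id i > (id j :: nat)} = {}" by auto
  then have "perm_inv 0 id = 0" unfolding perm_inv_def by (simp only: card.empty)
  then show ?thesis by (simp add: realises_def Asc_def)
qed

lemma realises_Node:
  assumes x: "realises l x" and y: "realises r y"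
  shows "realises (Node l r) (dirsum (size l) x (cons_max (size r) y))"
proof -
  let ?k = "size l" and ?m = "size r"
  have px: "x permutes {1..?k}" and py: "y permutes {1..?m}" using x y by (auto simp: realises_def)
  note pc = cons_max_permutes[OF py]
  have n: "size (Node l r) = ?k + Suc ?m" by simp
  have k0: "(if ?k = 0 then 0 else 1::nat) = (if l = Leaf then 0 else 1)"
    "(if l = Leaf then 0 else 2 * ?k) = 2 * ?k" by (cases l; simp)+
  have card_Suc: "card (Suc ` Asc ?m y) = card (Asc ?m y)" by (rule card_image) simp
  have sum_Suc: "\<Sum>(Suc ` Asc ?m y) = \<Sum>(Asc ?m y) + card (Asc ?m y)"
    by (simp add: sum.reindex sum_Suc)
  have X: "perm_inv ?k x = shape_area l" "card (Asc ?k x) = shape_val l"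
      "card (Asc ?k (inv x)) = shape_val l" "\<Sum>(Asc ?k x) + \<Sum>(Asc ?k (inv x)) = shape_maj l"
    and Y: "perm_inv ?m y = shape_area r" "card (Asc ?m y) = shape_val r"
      "card (Asc ?m (inv y)) = shape_val r" "\<Sum>(Asc ?m y) + \<Sum>(Asc ?m (inv y)) = shape_maj r"
    using x y unfolding realises_def by blast+
  note inner = Asc_cons_max[OF py] Asc_inv_cons_max[OF py] card_Suc sum_Suc X(1-3) Y(1-3)
  have pos: "1 \<le> Suc ?m" by simp
  note ipx = permutes_inv[OF px] and ipc = permutes_inv[OF pc]
  have 1: "perm_inv (?k + Suc ?m) (dirsum ?k x (cons_max ?m y)) = shape_area (Node l r)"
    unfolding perm_inv_dirsum[OF px pc] perm_inv_cons_max[OF py] inner by simp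
  have 2: "card (Asc (?k + Suc ?m) (dirsum ?k x (cons_max ?m y))) = shape_val (Node l r)"
    unfolding card_Asc_dirsum[OF px pc pos] inner k0 by simp
  have 3: "card (Asc (?k + Suc ?m) (dirsum ?k (inv x) (inv (cons_max ?m y)))) = shape_val (Node l r)"
    unfolding card_Asc_dirsum[OF ipx ipc pos] inner k0 by simp
  have "\<Sum>(Asc (?k + Suc ?m) (dirsum ?k x (cons_max ?m y)))
      = \<Sum>(Asc ?k x) + ?k + (\<Sum>(Asc ?m y) + shape_val r + ?k * shape_val r)"
    unfolding sum_Asc_dirsum[OF px pc pos] inner by simp
  moreover have "\<Sum>(Asc (?k + Suc ?m) (dirsum ?k (inv x) (inv (cons_max ?m y))))
      = \<Sum>(Asc ?k (inv x)) + ?k + (\<Sum>(Asc ?m (inv y)) + ?k * shape_val r)"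
    unfolding sum_Asc_dirsum[OF ipx ipc pos] inner by simp
  moreover have "shape_maj (Node l r)
      = shape_maj l + 2 * ?k + shape_maj r + shape_val r + 2 * (?k * shape_val r)"
    unfolding shape_maj.simps k0 by (simp add: algebra_simps)
  ultimately have 4: "\<Sum>(Asc (?k + Suc ?m) (dirsum ?k x (cons_max ?m y)))
      + \<Sum>(Asc (?k + Suc ?m) (dirsum ?k (inv x) (inv (cons_max ?m y)))) = shape_maj (Node l r)"
    using X(4) Y(4) by linarith
  show ?thesis
    unfolding realises_def n inv_dirsum[OF px pc]
    using dirsum_permutes[OF px pc] 1 2 3 4 by blast
qed

text \<open>
  Inverting the right summand is the same as inverting the whole sum after inverting the left
  summand, and \<open>realises\<close> does not notice inverses.
\<close>

lemma realises_Node_inv: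
  assumes x: "realises l x" and y: "realises r y"
  shows "realises (Node l r) (dirsum (size l) x (inv (cons_max (size r) y)))"
proof -
  have px: "x permutes {1..size l}" and py: "y permutes {1..size r}"
    using x y by (auto simp: realises_def)
  have "inv (dirsum (size l) (inv x) (cons_max (size r) y))
      = dirsum (size l) x (inv (cons_max (size r) y))"
    using inv_dirsum[OF permutes_inv[OF px] cons_max_permutes[OF py]]
    by (simp add: permutes_inv_inv[OF px])
  with realises_inv[OF realises_Node[OF realises_inv[OF x] y]] show ?thesis by simp
qed

section \<open>231-avoiding permutations\<close>

lemma Sort_permutes: "x \<in> Sort n \<Longrightarrow> x permutes {1..n}"
  by (simp add: Sort_def)

lemma Sort_D:
  "x \<in> Sort n \<Longrightarrow> 1 \<le> a \<Longrightarrow> a < b \<Longrightarrow> b < c \<Longrightarrow> c \<le> n \<Longrightarrow> x c < x a \<Longrightarrow> x a < x b \<Longrightarrow> False"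
  unfolding Sort_def by blast

lemma Sort_I:
  assumes "x permutes {1..n}"
    and "\<And>a b c. \<lbrakk>1 \<le> a; a < b; b < c; c \<le> n; x c < x a; x a < x b\<rbrakk> \<Longrightarrow> False"
  shows "x \<in> Sort n"
  unfolding Sort_def using assms by blast

lemma dirsum_in_Sort_iff:
  assumes x: "x permutes {1..k}" and y: "y permutes {1..m}"
  shows "dirsum k x y \<in> Sort (k + m) \<longleftrightarrow> x \<in> Sort k \<and> y \<in> Sort m"
proof
  assume z: "dirsum k x y \<in> Sort (k + m)"
  have "x \<in> Sort k"
  proof (rule Sort_I[OF x])
    fix a b c assume "1 \<le> a" "a < b" "b < c" "c \<le> k" "x c < x a" "x a < x b"
    then show False using Sort_D[OF z, of a b c] by (simp add: dirsum_def)
  qed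
  moreover have "y \<in> Sort m"
  proof (rule Sort_I[OF y])
    fix a b c assume "1 \<le> a" "a < b" "b < c" "c \<le> m" "y c < y a" "y a < y b"
    then show False using Sort_D[OF z, of "k + a" "k + b" "k + c"] by (simp add: dirsum_def)
  qed
  ultimately show "x \<in> Sort k \<and> y \<in> Sort m" by blast
next
  assume xy: "x \<in> Sort k \<and> y \<in> Sort m"
  show "dirsum k x y \<in> Sort (k + m)"
  proof (rule Sort_I[OF dirsum_permutes[OF x y]])
    fix a b c assume *: "1 \<le> a" "a < b" "b < c" "c \<le> k + m"
      "dirsum k x y c < dirsum k x y a" "dirsum k x y a < dirsum k x y b"
    show False
    proof (cases "a \<le> k")
      case True
      then have "x a \<le> k" by (rule permutes_ivl_le[OF x])
      then have "c \<le> k" using * True by (auto simp: dirsum_def split: if_splits)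
      then show False using * Sort_D[of x k a b c] xy by (simp add: dirsum_def)
    next
      case False
      then have "1 \<le> a - k" "a - k < b - k" "b - k < c - k" "c - k \<le> m"
        "y (c - k) < y (a - k)" "y (a - k) < y (b - k)"
        using * by (simp_all add: dirsum_def)
      then show False using Sort_D xy by blast
    qed
  qed
qed

lemma cons_max_in_Sort_iff:
  assumes y: "y permutes {1..m}"
  shows "cons_max m y \<in> Sort (Suc m) \<longleftrightarrow> y \<in> Sort m"
proof
  assume z: "cons_max m y \<in> Sort (Suc m)"
  show "y \<in> Sort m"
  proof (rule Sort_I[OF y])
    fix a b c assume "1 \<le> a" "a < b" "b < c" "c \<le> m" "y c < y a" "y a < y b"
    then show False using Sort_D[OF z, of "Suc a" "Suc b" "Suc c"] by (simp add: cons_max_def)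
  qed
next
  assume ys: "y \<in> Sort m"
  show "cons_max m y \<in> Sort (Suc m)"
  proof (rule Sort_I[OF cons_max_permutes[OF y]])
    fix a b c assume *: "1 \<le> a" "a < b" "b < c" "c \<le> Suc m"
      "cons_max m y c < cons_max m y a" "cons_max m y a < cons_max m y b"
    have "cons_max m y b \<le> Suc m" using * by (intro permutes_ivl_le[OF cons_max_permutes[OF y]]) simp
    then have "a \<noteq> 1" using * by (auto simp: cons_max_def)
    then have "1 \<le> a - 1" "a - 1 < b - 1" "b - 1 < c - 1" "c - 1 \<le> m"
      "y (c - 1) < y (a - 1)" "y (a - 1) < y (b - 1)"
      using * by (simp_all add: cons_max_def)
    then show False using Sort_D[OF ys] by blast
  qed
qed

text \<open>
  To the left of the maximum all entries of a 231-avoiding permutation are smaller than all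
  entries to the right of it.
\<close>

lemma Sort_split:
  assumes z: "z \<in> Sort (Suc n)"
  shows "\<exists>k m x y. k + m = n \<and> x \<in> Sort k \<and> y \<in> Sort m \<and> z = dirsum k x (cons_max m y)"
proof -
  note pz = Sort_permutes[OF z]
  define p where "p = inv z (Suc n)"
  have zp: "z p = Suc n" by (simp add: p_def permutes_inverses(1)[OF pz])
  have p: "1 \<le> p" "p \<le> Suc n"
    using permutes_ivl_in[OF permutes_inv[OF pz], of "Suc n"] by (simp_all add: p_def)
  define k m where "k = p - 1" and "m = n - k"
  have km: "k + Suc m = Suc n" "k + m = n" "p = Suc k" using p by (auto simp: k_def m_def)
  have lt: "z a < z c" if "1 \<le> a" "a < p" "p < c" "c \<le> Suc n" for a c
  proof (rule ccontr)
    assume "\<not> z a < z c"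
    moreover have "z a \<noteq> z c" "z a \<noteq> z p" using that by (simp_all add: inj_eq[OF permutes_inj[OF pz]])
    moreover have "z a \<le> Suc n" using permutes_ivl_le[OF pz, of a] that p by simp
    ultimately show False using Sort_D[OF z, of a p c] that zp by simp
  qed
  \<comment> \<open>The \<open>Suc n - k\<close> entries from the maximum on all exceed \<open>z i\<close>.\<close>
  have pre: "z i \<le> k" if i: "1 \<le> i" "i \<le> k" for i
  proof -
    have "z ` {p..Suc n} \<subseteq> {z i<..Suc n}"
    proof
      fix v assume "v \<in> z ` {p..Suc n}"
      then obtain c where c: "p \<le> c" "c \<le> Suc n" "v = z c" by auto
      have "z i \<noteq> z p" using i km by (simp add: inj_eq[OF permutes_inj[OF pz]])
      moreover have "z i \<le> Suc n" using permutes_ivl_le[OF pz, of i] i km by simp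
      ultimately have "z i < z p" using zp by simp
      then have "z i < z c" using lt[of i c] c i km by (cases "c = p") auto
      then show "v \<in> {z i<..Suc n}" using c permutes_ivl_le[OF pz, of c] by simp
    qed
    then have "card (z ` {p..Suc n}) \<le> card {z i<..Suc n}" by (intro card_mono) auto
    also have "card (z ` {p..Suc n}) = Suc n - k"
      using km by (subst card_image[OF permutes_inj_on[OF pz]]) simp
    finally show ?thesis using km permutes_ivl_le[OF pz, of i] i by simp
  qed
  obtain x y where xy: "x permutes {1..k}" "y permutes {1..Suc m}" "z = dirsum k x y"
    using dirsum_split[of z k "Suc m"] pz pre unfolding km by blast
  have "y 1 = Suc m" using zp km xy(3) by (simp add: dirsum_def)
  then obtain y' where y': "y' permutes {1..m}" "y = cons_max m y'"
    using cons_max_split[OF xy(2)] by blast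
  have "x \<in> Sort k \<and> y \<in> Sort (Suc m)"
    using dirsum_in_Sort_iff[OF xy(1,2)] z xy(3) km by simp
  then show ?thesis using y' cons_max_in_Sort_iff[OF y'(1)] xy(3) km by blast
qed

definition Sort_of :: "shape \<Rightarrow> nat \<Rightarrow> nat" where
  "Sort_of = build id (\<lambda>k m x y. dirsum k x (cons_max m y))"

lemma realises_Sort_of: "realises t (Sort_of t)"
  unfolding Sort_of_def by (induction t) (simp_all only: build.simps realises_Leaf realises_Node)

lemma bij_betw_Sort_of: "bij_betw Sort_of {t. size t = n} (Sort n)"
  unfolding Sort_of_def
proof (rule bij_betw_build)
  show "Sort 0 = {id}" by (auto simp: Sort_def)
next
  fix k m x y assume "x \<in> Sort k" "y \<in> Sort m"
  then show "dirsum k x (cons_max m y) \<in> Sort (Suc (k + m))"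
    using dirsum_in_Sort_iff[of x k "cons_max m y" "Suc m"] Sort_permutes cons_max_permutes
      cons_max_in_Sort_iff by simp
next
  fix k m x y k' m' x' y'
  assume mem: "x \<in> Sort k" "y \<in> Sort m" "x' \<in> Sort k'" "y' \<in> Sort m'" and km: "k + m = k' + m'"
    and eq: "dirsum k x (cons_max m y) = dirsum k' x' (cons_max m' y')"
  note p = mem[THEN Sort_permutes]
  \<comment> \<open>The position of the maximum tells where the direct sum splits.\<close>
  have "dirsum k x (cons_max m y) (Suc k) = Suc (k + m)" by (simp add: dirsum_def cons_max_def)
  moreover have "dirsum k' x' (cons_max m' y') (Suc k') = Suc (k' + m')"
    by (simp add: dirsum_def cons_max_def)
  ultimately have "dirsum k x (cons_max m y) (Suc k) = dirsum k x (cons_max m y) (Suc k')"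
    using km eq by simp
  then have k: "k = k'"
    using injD[OF permutes_inj[OF dirsum_permutes[OF p(1) cons_max_permutes[OF p(2)]]]] by blast
  then have m: "m = m'" using km by simp
  have "x = x' \<and> cons_max m y = cons_max m y'"
    using dirsum_inject[OF p(1) cons_max_permutes[OF p(2)] _ _ eq[folded k m]] p(3,4) k m
      cons_max_permutes by blast
  then show "k = k' \<and> x = x' \<and> y = y'" using cons_max_inject[of y m y'] p(2,4) k m by blast
qed (rule Sort_split)

section \<open>Noncrossing permutations\<close>

text \<open>
  A description of noncrossing permutations without blocks. If \<open>x\<close> jumps forward from \<open>i\<close>, then
  \<open>i\<close> and \<open>x i\<close> are consecutive elements of their block, so a block that meets the gap between
  them lies inside it. Otherwise \<open>i\<close> is the last and \<open>x i\<close> the first element of a block, and a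
  block that meets the interval between them lies inside it.
\<close>

definition noncrossing_perm :: "nat \<Rightarrow> (nat \<Rightarrow> nat) \<Rightarrow> bool" where
  "noncrossing_perm n x \<longleftrightarrow> x permutes {1..n} \<and>
     (\<forall>i j. i < j \<and> j < x i \<longrightarrow> i < x j \<and> x j < x i) \<and>
     (\<forall>i j. x i \<le> j \<and> j \<le> i \<longrightarrow> x i \<le> x j \<and> x j \<le> i)"

lemma noncrossing_perm_permutes: "noncrossing_perm n x \<Longrightarrow> x permutes {1..n}"
  by (simp add: noncrossing_perm_def)

lemma noncrossing_perm_forward:
  "noncrossing_perm n x \<Longrightarrow> i < j \<Longrightarrow> j < x i \<Longrightarrow> i < x j \<and> x j < x i"
  by (simp add: noncrossing_perm_def)

lemma noncrossing_perm_back: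
  "noncrossing_perm n x \<Longrightarrow> x i \<le> j \<Longrightarrow> j \<le> i \<Longrightarrow> x i \<le> x j \<and> x j \<le> i"
  by (simp add: noncrossing_perm_def)

lemma noncrossing_permI:
  assumes "x permutes {1..n}"
    and "\<And>i j. i < j \<Longrightarrow> j < x i \<Longrightarrow> i < x j \<and> x j < x i"
    and "\<And>i j. x i \<le> j \<Longrightarrow> j \<le> i \<Longrightarrow> x i \<le> x j \<and> x j \<le> i"
  shows "noncrossing_perm n x"
  unfolding noncrossing_perm_def using assms by blast

subsection \<open>Cycles of noncrossing partitions\<close>

text \<open>
  The three properties determine the value of the cycle: it is the successor of \<open>i\<close> in \<open>B\<close>, or the
  minimum of \<open>B\<close> if \<open>i\<close> is the maximum.
\<close>

lemma cycle_of_sorted_list: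
  fixes B :: "nat set"
  assumes fin: "finite B" and i: "i \<in> B"
  defines "f \<equiv> cycle_of_list (sorted_list_of_set B)"
  shows "f i \<in> B" and "i < f i \<Longrightarrow> B \<inter> {i<..<f i} = {}" and "f i \<le> i \<Longrightarrow> B \<subseteq> {f i..i}"
proof -
  let ?xs = "sorted_list_of_set B"
  have set: "set ?xs = B" and dist: "distinct ?xs" and sorted: "sorted ?xs" using fin by auto
  have less: "p < q \<Longrightarrow> q < length ?xs \<Longrightarrow> ?xs ! p < ?xs ! q" for p q
    using sorted dist by (metis less_trans nat_less_le nth_eq_iff_index_eq sorted_iff_nth_mono)
  obtain p where p: "p < length ?xs" "?xs ! p = i" using i set by (metis in_set_conv_nth)
  have "map f ?xs = rotate1 ?xs" using cyclic_rotation[OF dist, of 1] by (simp add: f_def)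
  then have "f i = rotate1 ?xs ! p" using p by (metis nth_map)
  then have fi: "f i = ?xs ! (Suc p mod length ?xs)" using p by (simp add: nth_rotate1)
  have idx: "Suc p mod length ?xs < length ?xs" using p by (intro mod_less_divisor) auto
  then show "f i \<in> B" unfolding fi using set nth_mem by blast
  have nth: "\<exists>q < length ?xs. ?xs ! q = j" if "j \<in> B" for j using that set by (metis in_set_conv_nth)
  consider (inner) "Suc p < length ?xs" | (last) "Suc p = length ?xs" using p by linarith
  then have "(i < f i \<longrightarrow> B \<inter> {i<..<f i} = {}) \<and> (f i \<le> i \<longrightarrow> B \<subseteq> {f i..i})"
  proof cases
    case inner
    then have "f i = ?xs ! Suc p" using fi by simp
    moreover have "j \<le> i \<or> ?xs ! Suc p \<le> j" if j: "j \<in> B" for j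
    proof -
      obtain q where q: "q < length ?xs" "?xs ! q = j" using nth[OF j] by blast
      show ?thesis
      proof (cases "q \<le> p")
        case True
        then show ?thesis using less[of q p] p q by (cases "q = p") auto
      next
        case False
        then show ?thesis using less[of "Suc p" q] q by (cases "q = Suc p") auto
      qed
    qed
    moreover have "i < f i" using less[of p "Suc p"] inner p \<open>f i = ?xs ! Suc p\<close> by simp
    ultimately show ?thesis by force
  next
    case last
    then have "f i = ?xs ! 0" using fi by simp
    moreover have "?xs ! 0 \<le> j \<and> j \<le> i" if j: "j \<in> B" for j
    proof -
      obtain q where q: "q < length ?xs" "?xs ! q = j" using nth[OF j] by blast
      show ?thesis using less[of 0 q] less[of q p] p q last by (cases "q = 0"; cases "q = p") auto
    qed
    ultimately show ?thesis using i by (force simp: not_le[symmetric])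
  qed
  then show "i < f i \<Longrightarrow> B \<inter> {i<..<f i} = {}" and "f i \<le> i \<Longrightarrow> B \<subseteq> {f i..i}" by blast+
qed

lemma perm_of_partition_block:
  assumes P: "partition_on A P" and B: "B \<in> P" and i: "i \<in> B"
  shows "perm_of_partition P i = cycle_of_list (sorted_list_of_set B) i"
proof -
  have "(THE B. B \<in> P \<and> i \<in> B) = B"
    using P B i by (intro the_equality) (auto simp: partition_on_def pairwise_def disjnt_def)
  then show ?thesis using B i by (auto simp: perm_of_partition_def)
qed

text \<open>
  If the block \<open>C\<close> of \<open>j\<close> is not the block \<open>B\<close> of \<open>i\<close>, a point of \<open>C\<close> outside the interval between
  \<open>i\<close> and its image makes \<open>C\<close> cross \<open>B\<close>, since both ends of the interval belong to \<open>B\<close>.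
\<close>

lemma noncrossing_perm_of_partition:
  assumes P: "partition_on {1..n} P" and nc: "noncrossing P"
  shows "noncrossing_perm n (perm_of_partition P)"
proof -
  let ?x = "perm_of_partition P"
  have un: "\<Union>P = {1..n}" using P by (auto dest: partition_onD1)
  have fin: "finite B" if "B \<in> P" for B using that un by (metis Union_upper finite_atLeastAtMost finite_subset)
  have disj: "B = C" if "B \<in> P" "C \<in> P" "i \<in> B" "i \<in> C" for B C i
    using that P by (auto simp: partition_on_def pairwise_def disjnt_def)
  have no_cross: "A = B" if "A \<in> P" "B \<in> P" "a < b" "b < c" "c < d" "a \<in> A" "c \<in> A" "b \<in> B" "d \<in> B"
    for A B a b c d
    using nc that unfolding noncrossing_def by blast
  note eq = perm_of_partition_block[OF P]
  have block: "?x i \<in> B" "i < ?x i \<Longrightarrow> B \<inter> {i<..<?x i} = {}" "?x i \<le> i \<Longrightarrow> B \<subseteq> {?x i..i}"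
    if "B \<in> P" "i \<in> B" for B i
    using cycle_of_sorted_list[OF fin[OF that(1)] that(2)] by (simp_all add: eq[OF that])
  have out: "?x i = i" if "i \<notin> {1..n}" for i
    using that unfolding un[symmetric] perm_of_partition_def by (simp only: if_False)
  have perm: "?x permutes {1..n}"
  proof (rule inj_imp_permutes)
    show "inj_on ?x {1..n}"
    proof (rule inj_onI)
      fix i j assume ij: "i \<in> {1..n}" "j \<in> {1..n}" "?x i = ?x j"
      then obtain B C where BC: "B \<in> P" "i \<in> B" "C \<in> P" "j \<in> C" using un by blast
      with ij(3) have "B = C" using block(1) disj by metis
      then have "cycle_of_list (sorted_list_of_set B) i = cycle_of_list (sorted_list_of_set B) j"
        using ij(3) BC eq by metis
      then show "i = j"
        using injD[OF permutes_inj[OF cycle_permutes]] by metis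
    qed
    show "?x i \<in> {1..n}" if "i \<in> {1..n}" for i using that un block(1) by blast
  qed (use out in auto)
  have in_block: "\<exists>B\<in>P. i \<in> B" if "i \<in> {1..n}" for i using that un by blast
  show ?thesis
  proof (rule noncrossing_permI[OF perm])
    fix i j assume ij: "i < j" "j < ?x i"
    then have "i \<in> {1..n}" using out[of i] by fastforce
    then obtain B where B: "B \<in> P" "i \<in> B" using in_block by blast
    have "?x i \<in> {1..n}" using permutes_in_image[OF perm] \<open>i \<in> {1..n}\<close> by blast
    then have "j \<in> {1..n}" using ij \<open>i \<in> {1..n}\<close> by simp
    then obtain C where C: "C \<in> P" "j \<in> C" using in_block by blast
    have "j \<notin> B" using block(2)[OF B] ij by auto
    then have "B \<noteq> C" using C by blast
    then have "C \<inter> B = {}" using disj[OF C(1) B(1)] by blast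
    then have ne: "?x j \<noteq> i" "?x j \<noteq> ?x i" using block(1)[OF B] block(1)[OF C] B by fastforce+
    have "\<not> ?x j < i"
      using no_cross[OF C(1) B(1) _ ij, of "?x j"] B C block(1)[OF B] block(1)[OF C] \<open>B \<noteq> C\<close>
      by blast
    moreover have "\<not> ?x i < ?x j"
      using no_cross[OF B(1) C(1) ij, of "?x j"] B C block(1)[OF B] block(1)[OF C] \<open>B \<noteq> C\<close>
      by blast
    ultimately show "i < ?x j \<and> ?x j < ?x i" using ne by linarith
  next
    fix i j assume ij: "?x i \<le> j" "j \<le> i"
    show "?x i \<le> ?x j \<and> ?x j \<le> i"
    proof (cases "i \<in> {1..n}")
      case False
      then show ?thesis using out[of i] ij by auto
    next
      case True
      then obtain B where B: "B \<in> P" "i \<in> B" using in_block by blast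
      have sub: "B \<subseteq> {?x i..i}" using block(3)[OF B] ij by simp
      have "?x i \<in> {1..n}" using permutes_in_image[OF perm] True by blast
      then have "j \<in> {1..n}" using ij True by simp
      then obtain C where C: "C \<in> P" "j \<in> C" using in_block by blast
      show ?thesis
      proof (cases "C = B")
        case True
        then show ?thesis using block(1)[OF C] sub by auto
      next
        case False
        then have "C \<inter> B = {}" using disj[OF C(1) B(1)] by blast
        then have "j \<noteq> i" "j \<noteq> ?x i" using block(1)[OF B] B C by fastforce+
        then have ij': "?x i < j" "j < i" using ij by auto
        have "\<not> ?x j < ?x i"
          using no_cross[OF C(1) B(1) _ ij', of "?x j"] B C block(1)[OF B] block(1)[OF C] False by blast
        moreover have "\<not> i < ?x j"
          using no_cross[OF B(1) C(1) ij', of "?x j"] B C block(1)[OF B] block(1)[OF C] False by blast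
        ultimately show ?thesis by linarith
      qed
    qed
  qed
qed

lemma orbit_invariant:
  assumes "j \<in> orbit x i" and "i \<in> S" and "\<And>k. k \<in> S \<Longrightarrow> x k \<in> S"
  shows "j \<in> S"
  using assms by (induction rule: orbit.induct) auto

text \<open>
  The orbits have the properties that \<open>cycle_of_sorted_list\<close> asserts for blocks, because the
  intervals concerned are invariant.
\<close>

lemma orbit_noncrossing_perm:
  assumes x: "noncrossing_perm n x"
  shows "i < x i \<Longrightarrow> orbit x i \<inter> {i<..<x i} = {}" and "x i \<le> i \<Longrightarrow> orbit x i \<subseteq> {x i..i}"
proof -
  note px = noncrossing_perm_permutes[OF x]
  have perm: "permutation x" using px permutation_permutes by blast
  note self = permutation_self_in_orbit[OF perm]
  show "orbit x i \<inter> {i<..<x i} = {}" if "i < x i"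
  proof (rule ccontr)
    assume "orbit x i \<inter> {i<..<x i} \<noteq> {}"
    then obtain j where j: "j \<in> orbit x i" "j \<in> {i<..<x i}" by blast
    have "i \<in> orbit x j" using orbit_swap[OF self j(1)] .
    then have "i \<in> {i<..<x i}"
      by (rule orbit_invariant) (use j noncrossing_perm_forward[OF x, of i] in auto)
    then show False by simp
  qed
  show "orbit x i \<subseteq> {x i..i}" if "x i \<le> i"
  proof
    fix j assume "j \<in> orbit x i"
    then show "j \<in> {x i..i}"
      by (rule orbit_invariant) (use that noncrossing_perm_back[OF x, of i] in auto)
  qed
qed

lemma noncrossing_perm_in_NC:
  assumes x: "noncrossing_perm n x"
  shows "x \<in> NC n"
proof -
  note px = noncrossing_perm_permutes[OF x]
  have perm: "permutation x" using px permutation_permutes by blast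
  note self = permutation_self_in_orbit[OF perm] and gaps = orbit_noncrossing_perm[OF x]
  let ?P = "orbit x ` {1..n}"
  have eq: "orbit x j = orbit x i" if "j \<in> orbit x i" for i j
    using that orbit_swap[OF self that] by (auto intro: orbit_trans)
  have part: "partition_on {1..n} ?P"
  proof (rule partition_onI)
    show "\<Union>?P = {1..n}" using self permutes_orbit_subset[OF px] by blast
    show "disjnt A B" if "A \<in> ?P" "B \<in> ?P" "A \<noteq> B" for A B
      using that eq unfolding disjnt_def by blast
    show "{} \<notin> ?P" using self by blast
  qed
  have nc: "noncrossing ?P"
    unfolding noncrossing_def
  proof (rule notI, elim exE bexE conjE)
    fix a b c d A B
    assume A: "A \<in> ?P" "B \<in> ?P" "A \<noteq> B" and abcd: "a < b" "b < c" "c < d"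
      and mem: "a \<in> A" "c \<in> A" "b \<in> B" "d \<in> B"
    have orb: "A = orbit x i" if "i \<in> A" for i using that A(1) eq by blast
    have B: "B = orbit x b" using mem A(2) eq by blast
    have "b \<notin> A" using orb[of b] B A(3) by blast
    \<comment> \<open>The element of \<open>A\<close> preceding \<open>b\<close> jumps over \<open>b\<close>, so all of \<open>B\<close> lies in that gap.\<close>
    define i where "i = Max {i \<in> A. i < b}"
    have "i \<in> {i \<in> A. i < b}" unfolding i_def by (rule Max_in) (use abcd mem in auto)
    then have i: "i \<in> A" "i < b" by auto
    have max: "j \<le> i" if "j \<in> A" "j < b" for j unfolding i_def by (rule Max_ge) (use that in auto)
    have step: "x i \<in> A" unfolding orb[OF i(1)] by (rule orbit.base)
    have fwd: "i < x i"
    proof (rule ccontr)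
      assume "\<not> i < x i"
      then have "c \<le> i" using gaps(2)[of i] orb[OF i(1)] mem by auto
      then show False using i abcd by simp
    qed
    then have "\<not> x i < b" using max[OF step] by auto
    then have "b < x i" using \<open>b \<notin> A\<close> step by (cases "b = x i") auto
    moreover have "\<not> c < x i" using gaps(1)[OF fwd] orb[OF i(1)] mem i abcd by auto
    moreover have "d \<in> {i<..<x i}" if "b < x i"
    proof (rule orbit_invariant)
      show "d \<in> orbit x b" using mem B by simp
    qed (use that i noncrossing_perm_forward[OF x, of i] in auto)
    ultimately show False using abcd by simp
  qed
  have "perm_of_partition ?P i = x i" for i
  proof (cases "i \<in> {1..n}")
    case True
    let ?O = "orbit x i" and ?y = "perm_of_partition ?P i"
    have fin: "finite ?O" using finite_orbit[OF self] .
    have y: "?y = cycle_of_list (sorted_list_of_set ?O) i"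
      by (rule perm_of_partition_block[OF part]) (use True self in auto)
    note c = cycle_of_sorted_list[OF fin self, folded y]
    have "x i \<in> ?O" by (rule orbit.base)
    then show ?thesis
      using c gaps[of i] self[of i] by (cases "i < x i"; cases "i < ?y") force+
  next
    case False
    moreover from this have "i \<notin> \<Union>?P" unfolding partition_onD1[OF part, symmetric] .
    ultimately show ?thesis
      unfolding perm_of_partition_def using permutes_not_in[OF px False] by (simp only: if_False)
  qed
  then have "x = perm_of_partition ?P" by auto
  with part nc show ?thesis unfolding NC_def by blast
qed

lemma NC_eq: "NC n = {x. noncrossing_perm n x}"
proof (intro subset_antisym subsetI)
  fix x assume "x \<in> NC n"
  then obtain P where "partition_on {1..n} P" "noncrossing P" "x = perm_of_partition P"
    unfolding NC_def by blast
  then show "x \<in> {x. noncrossing_perm n x}" using noncrossing_perm_of_partition by simp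
qed (simp add: noncrossing_perm_in_NC)

subsection \<open>The recursion for noncrossing permutations\<close>

lemma dirsum_noncrossing_perm_iff:
  assumes x: "x permutes {1..k}" and y: "y permutes {1..m}"
  shows "noncrossing_perm (k + m) (dirsum k x y) \<longleftrightarrow> noncrossing_perm k x \<and> noncrossing_perm m y"
proof
  let ?z = "dirsum k x y"
  assume z: "noncrossing_perm (k + m) ?z"
  have zx: "?z i = x i" if "i \<le> k" for i using that by (simp add: dirsum_def)
  have zy: "?z (k + i) = k + y i" if "1 \<le> i" for i using that by (simp add: dirsum_def)
  have "noncrossing_perm k x"
  proof (rule noncrossing_permI[OF x])
    fix i j assume ij: "i < j" "j < x i"
    then have "i \<le> k" using permutes_ivl_out[OF x, of i] by (cases "i \<le> k") auto
    then have "j \<le> k" using permutes_ivl_le[OF x, of i] ij by simp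
    then show "i < x j \<and> x j < x i"
      using noncrossing_perm_forward[OF z, of i j] ij \<open>i \<le> k\<close> by (simp add: zx)
  next
    fix i j assume ij: "x i \<le> j" "j \<le> i"
    show "x i \<le> x j \<and> x j \<le> i"
    proof (cases "i \<le> k")
      case True
      then show ?thesis using noncrossing_perm_back[OF z, of i j] ij by (simp add: zx)
    next
      case False
      then show ?thesis using permutes_ivl_out[OF x, of i] ij by auto
    qed
  qed
  moreover have "noncrossing_perm m y"
  proof (rule noncrossing_permI[OF y])
    fix i j assume ij: "i < j" "j < y i"
    then have "1 \<le> i" using permutes_ivl_out[OF y, of i] by (cases "i = 0") auto
    then show "i < y j \<and> y j < y i"
      using noncrossing_perm_forward[OF z, of "k + i" "k + j"] ij by (simp add: zy)
  next
    fix i j assume ij: "y i \<le> j" "j \<le> i"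
    show "y i \<le> y j \<and> y j \<le> i"
    proof (cases "i = 0")
      case True
      then show ?thesis using permutes_ivl_out[OF y, of 0] ij by simp
    next
      case False
      then have "1 \<le> i" "1 \<le> j" using permutes_ivl_pos[OF y, of i] ij by auto
      then show ?thesis using noncrossing_perm_back[OF z, of "k + i" "k + j"] ij by (simp add: zy)
    qed
  qed
  ultimately show "noncrossing_perm k x \<and> noncrossing_perm m y" by blast
next
  let ?z = "dirsum k x y"
  assume xy: "noncrossing_perm k x \<and> noncrossing_perm m y"
  have zx: "?z i = x i \<and> x i \<le> k" if "i \<le> k" for i
    using that permutes_ivl_le[OF x] by (simp add: dirsum_def)
  have zy: "?z i = k + y (i - k) \<and> 1 \<le> y (i - k)" if "k < i" for i
    using that permutes_ivl_pos[OF y, of "i - k"] by (simp add: dirsum_def)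
  show "noncrossing_perm (k + m) ?z"
  proof (rule noncrossing_permI[OF dirsum_permutes[OF x y]])
    fix i j assume ij: "i < j" "j < ?z i"
    show "i < ?z j \<and> ?z j < ?z i"
    proof (cases "i \<le> k")
      case True
      then have "j \<le> k" using zx[of i] ij by simp
      then show ?thesis using noncrossing_perm_forward[of k x i j] xy zx[of i] zx[of j] True ij by simp
    next
      case False
      then have "i - k < j - k" "j - k < y (i - k)" using zy[of i] ij by auto
      then have "i - k < y (j - k) \<and> y (j - k) < y (i - k)"
        using noncrossing_perm_forward xy by blast
      then show ?thesis using False ij zy[of i] zy[of j] by auto
    qed
  next
    fix i j assume ij: "?z i \<le> j" "j \<le> i"
    show "?z i \<le> ?z j \<and> ?z j \<le> i"
    proof (cases "i \<le> k")
      case True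
      then show ?thesis using noncrossing_perm_back[of k x i j] xy zx[of i] zx[of j] ij by simp
    next
      case False
      then have "k < j" using zy[of i] ij by auto
      then have "y (i - k) \<le> j - k" "j - k \<le> i - k" using zy[of i] ij False by auto
      then have "y (i - k) \<le> y (j - k) \<and> y (j - k) \<le> i - k"
        using noncrossing_perm_back xy by blast
      then show ?thesis using False \<open>k < j\<close> zy[of i] zy[of j] by auto
    qed
  qed
qed

lemma permutes_closed_iff:
  assumes x: "x permutes S" and fin: "finite A" and closed: "\<And>i. i \<in> A \<Longrightarrow> x i \<in> A"
  shows "x i \<in> A \<longleftrightarrow> i \<in> A"
proof -
  have "x ` A = A" using fin closed by (intro endo_inj_surj permutes_inj_on[OF x]) auto
  then show ?thesis using inj_image_mem_iff[OF permutes_inj[OF x]] by metis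
qed

text \<open>
  Since the inverse of \<open>cons_max m y\<close> sends \<open>y k\<close> to \<open>k + 1\<close>, it jumps forward from \<open>y k\<close> exactly
  if \<open>y k \<le> k\<close>. Thus the two closure conditions for \<open>y\<close> turn into the two closure conditions for
  that inverse in exchanged roles.
\<close>

lemma inv_cons_max_noncrossing_perm_iff:
  assumes y: "y permutes {1..m}"
  shows "noncrossing_perm (Suc m) (inv (cons_max m y)) \<longleftrightarrow> noncrossing_perm m y"
proof -
  define r where "r = inv (cons_max m y)"
  have pr: "r permutes {1..Suc m}"
    unfolding r_def by (rule permutes_inv[OF cons_max_permutes[OF y]])
  have r_eq: "r = (\<lambda>i. if i = 0 \<or> Suc m < i then i else if i = Suc m then 1 else Suc (inv y i))"
    unfolding r_def by (rule inv_cons_max[OF y])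
  have r_y: "r (y k) = Suc k" if "1 \<le> k" "k \<le> m" for k
    using permutes_ivl_in[OF y that] unfolding r_eq by (simp add: permutes_inverses(2)[OF y])
  have y_inv: "1 \<le> inv y i \<and> inv y i \<le> m \<and> y (inv y i) = i" if "1 \<le> i" "i \<le> m" for i
    using permutes_ivl_in[OF permutes_inv[OF y] that] permutes_inverses(1)[OF y] by blast
  have r_inv: "r i = Suc (inv y i)" if "1 \<le> i" "i \<le> m" for i using that unfolding r_eq by simp
  have "noncrossing_perm (Suc m) r" if ncy: "noncrossing_perm m y"
  proof (rule noncrossing_permI[OF pr])
    fix i j assume ij: "i < j" "j < r i"
    then have i: "1 \<le> i" "i \<le> m" unfolding r_eq by (auto split: if_splits)
    define k where "k = inv y i"
    have k: "y k = i" "k \<le> m" "r i = Suc k" using y_inv[OF i] r_inv[OF i] by (auto simp: k_def)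
    have closed: "y l \<in> {i..k} \<longleftrightarrow> l \<in> {i..k}" for l
      by (rule permutes_closed_iff[OF y]) (use noncrossing_perm_back[OF ncy, of k] k ij in auto)
    have j: "1 \<le> j" "j \<le> m" using ij k(2,3) i by simp_all
    have "j \<in> {i..k}" using ij k(3) by simp
    then have "inv y j \<in> {i..k}" using closed[of "inv y j"] y_inv[OF j] by simp
    moreover have "inv y j \<noteq> k" using y_inv[OF j] k(1) ij(1) by fastforce
    ultimately show "i < r j \<and> r j < r i" unfolding r_inv[OF j] k(3) by simp
  next
    fix i j assume ij: "r i \<le> j" "j \<le> i"
    consider "i = 0 \<or> Suc m < i" | "i = Suc m" | "1 \<le> i" "i \<le> m" by linarith
    then show "r i \<le> r j \<and> r j \<le> i"
    proof cases
      case 1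
      then have "r i = i" unfolding r_eq by auto
      then show ?thesis using ij by auto
    next
      case 2
      then have "r i = 1" unfolding r_eq by auto
      then show ?thesis using permutes_ivl_in[OF pr, of j] ij 2 by auto
    next
      case i: 3
      define k where "k = inv y i"
      have k: "y k = i" "r i = Suc k" using y_inv[OF i] r_inv[OF i] by (auto simp: k_def)
      show ?thesis
      proof (cases "j = i")
        case True
        then show ?thesis using ij by auto
      next
        case False
        have closed: "y l \<in> {k<..<i} \<longleftrightarrow> l \<in> {k<..<i}" for l
          by (rule permutes_closed_iff[OF y]) (use noncrossing_perm_forward[OF ncy, of k] k in auto)
        have j: "1 \<le> j" "j \<le> m" using ij k(2) i by simp_all
        have "j \<in> {k<..<i}" using ij k(2) False by simp
        then have "inv y j \<in> {k<..<i}" using closed[of "inv y j"] y_inv[OF j] by simp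
        then show ?thesis unfolding r_inv[OF j] k(2) by simp
      qed
    qed
  qed
  moreover have "noncrossing_perm m y" if ncr: "noncrossing_perm (Suc m) r"
  proof (rule noncrossing_permI[OF y])
    fix k j assume kj: "k < j" "j < y k"
    then have k: "1 \<le> k" "k \<le> m"
      using permutes_ivl_out[OF y, of k] by (cases "1 \<le> k"; cases "k \<le> m"; simp)+
    then have j: "1 \<le> j" "j \<le> m" using kj permutes_ivl_in[OF y, of k] by auto
    note ry = r_y[OF k] r_y[OF j]
    have closed: "r l \<in> {Suc k..y k} \<longleftrightarrow> l \<in> {Suc k..y k}" for l
      by (rule permutes_closed_iff[OF pr]) (use noncrossing_perm_back[OF ncr, of "y k"] ry kj in auto)
    have "r (y j) \<in> {Suc k..y k}" unfolding ry(2) using kj by simp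
    then have "y j \<in> {Suc k..y k}" unfolding closed .
    moreover have "y j \<noteq> y k" using kj by (simp add: inj_eq[OF permutes_inj[OF y]])
    ultimately show "k < y j \<and> y j < y k" by simp
  next
    fix k j assume kj: "y k \<le> j" "j \<le> k"
    show "y k \<le> y j \<and> y j \<le> k"
    proof (cases "(1 \<le> k \<and> k \<le> m) \<and> j \<noteq> k")
      case True
      then have k: "1 \<le> k" "k \<le> m" by auto
      then have j: "1 \<le> j" "j \<le> m" using kj permutes_ivl_in[OF y, of k] by auto
      note ry = r_y[OF k] r_y[OF j]
      have closed: "r l \<in> {y k<..<Suc k} \<longleftrightarrow> l \<in> {y k<..<Suc k}" for l
        by (rule permutes_closed_iff[OF pr]) (use noncrossing_perm_forward[OF ncr, of "y k"] ry in auto)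
      have "r (y j) \<in> {y k<..<Suc k}" unfolding ry(2) using kj True by simp
      then have "y j \<in> {y k<..<Suc k}" unfolding closed .
      then show ?thesis by auto
    next
      case False
      then have "j = k \<or> y k = k" using permutes_ivl_out[OF y, of k] by linarith
      then have "j = k" using kj by auto
      then show ?thesis using kj by auto
    qed
  qed
  ultimately show ?thesis unfolding r_def by blast
qed

text \<open>
  The interval from the image of the last point to the last point is invariant, so the permutation
  splits in front of it.
\<close>

lemma noncrossing_perm_split:
  assumes z: "noncrossing_perm (Suc n) z"
  shows "\<exists>k m x y. k + m = n \<and> noncrossing_perm k x \<and> noncrossing_perm m y \<and>
    z = dirsum k x (inv (cons_max m y))"
proof -
  note pz = noncrossing_perm_permutes[OF z]
  define q where "q = z (Suc n)"
  have q: "1 \<le> q" "q \<le> Suc n" using permutes_ivl_in[OF pz, of "Suc n"] by (simp_all add: q_def)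
  define k m where "k = q - 1" and "m = n - k"
  have km: "k + Suc m = Suc n" "k + m = n" "q = Suc k" using q by (auto simp: k_def m_def)
  have closed: "z i \<in> {q..Suc n} \<longleftrightarrow> i \<in> {q..Suc n}" for i
    by (rule permutes_closed_iff[OF pz])
      (use noncrossing_perm_back[OF z, of "Suc n"] in \<open>auto simp: q_def\<close>)
  have pre: "z i \<le> k" if "1 \<le> i" "i \<le> k" for i
    using closed[of i] permutes_ivl_le[OF pz, of i] that km by auto
  obtain x w where xw: "x permutes {1..k}" "w permutes {1..Suc m}" "z = dirsum k x w"
    using dirsum_split[of z k "Suc m"] pz pre unfolding km by blast
  have "z (Suc n) = k + w (Suc n - k)" unfolding xw(3) dirsum_def using km by simp
  moreover have "Suc n - k = Suc m" using km by simp
  ultimately have "w (Suc m) = 1" using km by (simp add: q_def)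
  then have "inv w 1 = Suc m" using permutes_inv_eq[OF xw(2)] by simp
  then obtain y where y: "y permutes {1..m}" "inv w = cons_max m y"
    using cons_max_split[OF permutes_inv[OF xw(2)]] by blast
  then have w: "w = inv (cons_max m y)" using permutes_inv_inv[OF xw(2)] by simp
  have "noncrossing_perm k x \<and> noncrossing_perm (Suc m) w"
    using dirsum_noncrossing_perm_iff[OF xw(1,2)] z xw(3) km by simp
  then show ?thesis using inv_cons_max_noncrossing_perm_iff[OF y(1)] xw(3) km w by blast
qed

definition NC_of :: "shape \<Rightarrow> nat \<Rightarrow> nat" where
  "NC_of = build id (\<lambda>k m x y. dirsum k x (inv (cons_max m y)))"

lemma realises_NC_of: "realises t (NC_of t)"
  unfolding NC_of_def by (induction t) (simp_all only: build.simps realises_Leaf realises_Node_inv)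

lemma bij_betw_NC_of: "bij_betw NC_of {t. size t = n} (NC n)"
  unfolding NC_of_def NC_eq
proof (rule bij_betw_build)
  show "{x. noncrossing_perm 0 x} = {id}" by (auto simp: noncrossing_perm_def)
next
  fix k m x y assume "x \<in> {x. noncrossing_perm k x}" "y \<in> {x. noncrossing_perm m x}"
  then show "dirsum k x (inv (cons_max m y)) \<in> {x. noncrossing_perm (Suc (k + m)) x}"
    using dirsum_noncrossing_perm_iff[of x k "inv (cons_max m y)" "Suc m"]
      noncrossing_perm_permutes permutes_inv[OF cons_max_permutes]
      inv_cons_max_noncrossing_perm_iff by simp
next
  fix k m x y k' m' x' y'
  assume mem: "x \<in> {x. noncrossing_perm k x}" "y \<in> {x. noncrossing_perm m x}"
      "x' \<in> {x. noncrossing_perm k' x}" "y' \<in> {x. noncrossing_perm m' x}"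
    and km: "k + m = k' + m'"
    and eq: "dirsum k x (inv (cons_max m y)) = dirsum k' x' (inv (cons_max m' y'))"
  have p: "x permutes {1..k}" "y permutes {1..m}" "x' permutes {1..k'}" "y' permutes {1..m'}"
    using mem noncrossing_perm_permutes by auto
  \<comment> \<open>The value at the last point tells where the direct sum splits.\<close>
  have last: "dirsum k x (inv (cons_max m y)) (Suc (k + m)) = Suc k"
    if "y permutes {1..m}" for k m x y
    unfolding dirsum_def inv_cons_max[OF that] by simp
  have "Suc k = Suc k'" using last[OF p(2), of k x] last[OF p(4), of k' x'] eq km by metis
  then have k: "k = k'" and m: "m = m'" using km by auto
  have pc: "inv (cons_max m y) permutes {1..Suc m}" "inv (cons_max m y') permutes {1..Suc m}"
    using p(2,4) m permutes_inv cons_max_permutes by blast+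
  have "x = x' \<and> inv (cons_max m y) = inv (cons_max m y')"
    using dirsum_inject[OF p(1) pc(1) _ pc(2) eq[folded k m]] p(3) k by blast
  moreover from this have "cons_max m y = cons_max m y'"
    using permutes_inv_inv[OF cons_max_permutes] p(2,4) m by metis
  ultimately show "k = k' \<and> x = x' \<and> y = y'" using cons_max_inject[of y m y'] p(2,4) k m by blast
qed (use noncrossing_perm_split in auto)

section \<open>Dyck paths\<close>

lemma count_North_plus_East: "count_list w North + count_list w East = length w"
proof (induction w)
  case (Cons s w)
  then show ?case by (cases s) auto
qed simp

lemma Dyck_iff: "D \<in> Dyck n \<longleftrightarrow> count_list D North = n \<and> count_list D East = n \<and>
    (\<forall>u v. D = u @ v \<longrightarrow> count_list u East \<le> count_list u North)"
proof -
  have "(\<forall>k\<le>length D. fst (vertex D k) \<le> snd (vertex D k)) \<longleftrightarrow>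
      (\<forall>u v. D = u @ v \<longrightarrow> count_list u East \<le> count_list u North)"
  proof (intro iffI allI impI)
    fix u v assume D: "D = u @ v" and "\<forall>k\<le>length D. fst (vertex D k) \<le> snd (vertex D k)"
    then have "fst (vertex D (length u)) \<le> snd (vertex D (length u))" by simp
    then show "count_list u East \<le> count_list u North" by (simp add: D vertex_def)
  next
    fix k assume "\<forall>u v. D = u @ v \<longrightarrow> count_list u East \<le> count_list u North"
    then have "count_list (take k D) East \<le> count_list (take k D) North"
      using append_take_drop_id[of k D] by metis
    then show "fst (vertex D k) \<le> snd (vertex D k)" by (simp add: vertex_def)
  qed
  then show ?thesis by (simp add: Dyck_def)
qed

lemma Dyck_count: "D \<in> Dyck n \<Longrightarrow> count_list D North = n" "D \<in> Dyck n \<Longrightarrow> count_list D East = n"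
  by (simp_all add: Dyck_iff)

lemma Dyck_prefix: "u @ v \<in> Dyck n \<Longrightarrow> count_list u East \<le> count_list u North"
  by (simp add: Dyck_iff)

lemma Dyck_length: "D \<in> Dyck n \<Longrightarrow> length D = 2 * n"
  using count_North_plus_East[of D] by (simp add: Dyck_iff)

lemma Dyck_last:
  assumes "D \<in> Dyck n" and "D \<noteq> []"
  shows "last D = East"
proof (rule ccontr)
  assume "last D \<noteq> East"
  then have "last D = North" by (cases "last D") auto
  then have D: "D = butlast D @ [North]" using assms(2) append_butlast_last_id[of D] by simp
  have "count_list (butlast D) East \<le> count_list (butlast D) North"
    using Dyck_prefix[of "butlast D" "[North]" n] assms(1) D by simp
  moreover have "count_list D North = count_list (butlast D) North + 1"
    "count_list D East = count_list (butlast D) East" by (subst D, simp)+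
  ultimately show False using Dyck_count[OF assms(1)] by simp
qed

lemma Dyck_append_lift:
  assumes x: "x \<in> Dyck k" and y: "y \<in> Dyck m"
  shows "x @ North # y @ [East] \<in> Dyck (Suc (k + m))"
  unfolding Dyck_iff
proof (intro conjI allI impI)
  fix u v assume "x @ North # y @ [East] = u @ v"
  then consider us where "x = u @ us" | us where "u = x @ us" "North # y @ [East] = us @ v"
    by (auto simp: append_eq_append_conv2)
  then show "count_list u East \<le> count_list u North"
  proof cases
    case 1
    then show ?thesis using Dyck_prefix x by blast
  next
    case (2 us)
    note cx = Dyck_count[OF x]
    show ?thesis
    proof (cases us)
      case Nil
      then show ?thesis using 2 cx by simp
    next
      case (Cons s ws)
      then have s: "s = North" and "y @ [East] = ws @ v" using 2(2) by auto
      then consider ts where "y = ws @ ts" | "ws = y @ [East]"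
        by (auto simp: append_eq_append_conv2 Cons_eq_append_conv)
      then show ?thesis
      proof cases
        case (1 ts)
        then show ?thesis unfolding 2(1) Cons s using Dyck_prefix[of ws ts m] y 1 cx by simp
      next
        case whole: 2
        then show ?thesis unfolding 2(1) Cons whole s using Dyck_count[OF y] cx by simp
      qed
    qed
  qed
qed (use Dyck_count[OF x] Dyck_count[OF y] in auto)

text \<open>
  The path is cut at the last vertex before the end that lies on the diagonal; after it the path
  stays at least one step above the diagonal until its final east step.
\<close>

lemma Dyck_split:
  assumes z: "z \<in> Dyck (Suc n)"
  shows "\<exists>k m x y. k + m = n \<and> x \<in> Dyck k \<and> y \<in> Dyck m \<and> z = x @ North # y @ [East]"
proof -
  define K where "K = {j. j < length z \<and> count_list (take j z) North = count_list (take j z) East}"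
  define j where "j = Max K"
  have fin: "finite K" by (simp add: K_def)
  have "0 \<in> K" using Dyck_length[OF z] by (auto simp: K_def)
  then have "j \<in> K" unfolding j_def using fin by (intro Max_in) auto
  have max: "i \<le> j" if "i \<in> K" for i unfolding j_def using fin that by simp
  define x where "x = take j z"
  have j: "j < length z" and cx: "count_list x North = count_list x East" and lx: "length x = j"
    using \<open>j \<in> K\<close> by (auto simp: K_def x_def)
  obtain s w where z1: "z = x @ s # w" unfolding x_def using id_take_nth_drop[OF j] by blast
  have s: "s = North"
  proof (cases s)
    case East
    have "count_list (x @ [s]) East \<le> count_list (x @ [s]) North"
      by (rule Dyck_prefix[of _ w]) (use z z1 in simp)
    then show ?thesis using East cx by simp
  qed simp
  note cz = Dyck_count[OF z]
  have "w \<noteq> []"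
  proof
    assume "w = []"
    then show False using cz cx z1 s by simp
  qed
  then obtain y t where w: "w = y @ [t]" by (metis rev_exhaust)
  have cy: "count_list (x @ North # y) East \<le> count_list (x @ North # y) North"
    by (rule Dyck_prefix[of _ "[t]"]) (use z z1 s w in simp)
  have t: "t = East"
  proof (cases t)
    case North
    then show ?thesis using cy cz z1 s w by simp
  qed simp
  have zz: "z = x @ North # y @ [East]" using z1 s w t by simp
  have "x \<in> Dyck (count_list x North)"
    unfolding Dyck_iff using cx Dyck_prefix z zz by (metis append.assoc)
  moreover have "y \<in> Dyck (count_list y North)"
    unfolding Dyck_iff
  proof (intro conjI allI impI)
    show "count_list y East = count_list y North" using cz cx zz by simp
  next
    fix u v assume y: "y = u @ v"
    let ?p = "x @ North # u"
    have zp: "z = ?p @ v @ [East]" using zz y by simp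
    have "count_list ?p East \<le> count_list ?p North"
      by (rule Dyck_prefix[of _ "v @ [East]"]) (use z zp in simp)
    moreover have "length ?p \<notin> K" using max[of "length ?p"] lx by auto
    then have "count_list ?p North \<noteq> count_list ?p East"
      using zp unfolding K_def by simp
    ultimately show "count_list u East \<le> count_list u North" using cx by simp
  qed simp
  moreover have "count_list x North + count_list y North = n" using cz zz by simp
  ultimately show ?thesis using zz by blast
qed

text \<open>
  If the cuts of two decompositions differed, the right part belonging to the earlier cut would
  have a prefix descending below its starting level.
\<close>

lemma Dyck_append_lift_unique:
  assumes mem: "x \<in> Dyck k" "y \<in> Dyck m" "x' \<in> Dyck k'" "y' \<in> Dyck m'"
    and eq: "x @ North # y @ [East] = x' @ North # y' @ [East]"
  shows "k = k' \<and> x = x' \<and> y = y'"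
proof -
  have no: False
    if "a \<in> Dyck i" "a @ North # u \<in> Dyck j" "u @ v \<in> Dyck l" for a u v i j l
    using Dyck_count[OF that(1)] Dyck_count[OF that(2)] Dyck_prefix[OF that(3)] by simp
  have "x @ North # y = x' @ North # y'" using eq by simp
  then consider "x = x'" "y = y'"
    | u where "x = x' @ North # u" "y' = u @ North # y"
    | u where "x' = x @ North # u" "y = u @ North # y'"
    by (auto simp: append_eq_append_conv2 Cons_eq_append_conv append_eq_Cons_conv)
  then show ?thesis
  proof cases
    case 1
    then show ?thesis using mem Dyck_count by blast
  next
    case 2
    then show ?thesis using no mem by blast
  next
    case 3
    then show ?thesis using no mem by blast
  qed
qed

definition Dyck_of :: "shape \<Rightarrow> step list" where
  "Dyck_of = build [] (\<lambda>k m x y. x @ North # y @ [East])"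

lemma bij_betw_Dyck_of: "bij_betw Dyck_of {t. size t = n} (Dyck n)"
  unfolding Dyck_of_def
proof (rule bij_betw_build)
  have "D = []" if "D \<in> Dyck 0" for D using Dyck_length[OF that] by simp
  moreover have "[] \<in> Dyck 0" by (simp add: Dyck_iff)
  ultimately show "Dyck 0 = {[]}" by blast
next
  fix k m x y k' m' x' y'
  assume "x \<in> Dyck k" "y \<in> Dyck m" "x' \<in> Dyck k'" "y' \<in> Dyck m'"
    "x @ North # y @ [East] = x' @ North # y' @ [East]"
  then show "k = k' \<and> x = x' \<and> y = y'" by (rule Dyck_append_lift_unique)
next
  fix k m x y assume "x \<in> Dyck k" "y \<in> Dyck m"
  then show "x @ North # y @ [East] \<in> Dyck (Suc (k + m))" by (rule Dyck_append_lift)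
next
  fix n z assume "z \<in> Dyck (Suc n)"
  then show "\<exists>k m x y. k + m = n \<and> x \<in> Dyck k \<and> y \<in> Dyck m \<and> z = x @ North # y @ [East]"
    by (rule Dyck_split)
qed

lemma Dyck_of_mem: "Dyck_of t \<in> Dyck (size t)"
  using bij_betwE[OF bij_betw_Dyck_of] by blast

subsection \<open>Valleys\<close>

lemma path_Des_append_lift:
  assumes x: "x \<in> Dyck k"
  shows "path_Des (x @ North # y @ [East]) =
    path_Des x \<union> (if x = [] then {} else {length x}) \<union> (\<lambda>i. Suc (length x) + i) ` path_Des y"
    (is "path_Des ?z = ?R")
proof (intro subset_antisym subsetI)
  fix i assume "i \<in> path_Des ?z"
  then have i: "1 \<le> i" "i < length ?z" "?z ! (i - 1) = East" "?z ! i = North"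
    by (auto simp: path_Des_def)
  consider "i < length x" | "i = length x" | "i = Suc (length x)" | "Suc (length x) < i" by linarith
  then show "i \<in> ?R"
  proof cases
    case 1
    then show ?thesis using i by (simp add: path_Des_def nth_append less_imp_diff_less)
  next
    case 2
    then show ?thesis using i by auto
  next
    case 3
    then show ?thesis using i by (simp add: nth_append)
  next
    case 4
    define q where "q = i - Suc (length x)"
    have q: "i = Suc (length x) + q" "1 \<le> q" using 4 by (auto simp: q_def)
    have "(y @ [East]) ! q = North" "(y @ [East]) ! (q - 1) = East" "q < Suc (length y)"
      using i q by (auto simp: nth_append nth_Cons')
    then have "q \<noteq> length y" "q < Suc (length y)" by (auto simp: nth_append)
    then have "q < length y" "q - 1 < length y" by auto
    then have "q \<in> path_Des y"
      using q(2) \<open>(y @ [East]) ! q = North\<close> \<open>(y @ [East]) ! (q - 1) = East\<close>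
      by (simp add: path_Des_def nth_append)
    then show ?thesis using q by blast
  qed
next
  fix i assume "i \<in> ?R"
  then consider "i \<in> path_Des x" | "i = length x" "x \<noteq> []"
    | q where "i = Suc (length x) + q" "q \<in> path_Des y"
    by (auto split: if_splits)
  then show "i \<in> path_Des ?z"
  proof cases
    case 1
    then show ?thesis by (auto simp: path_Des_def nth_append)
  next
    case 2
    then show ?thesis using Dyck_last[OF x] by (cases "length x") (auto simp: path_Des_def nth_append last_conv_nth)
  next
    case (3 q)
    then show ?thesis by (auto simp: path_Des_def nth_append nth_Cons')
  qed
qed

lemma finite_path_Des [simp]: "finite (path_Des w)"
  by (rule finite_subset[of _ "{..length w}"]) (auto simp: path_Des_def)

lemma
  assumes x: "x \<in> Dyck k"
  shows card_path_Des_append_lift: "card (path_Des (x @ North # y @ [East])) =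
      card (path_Des x) + (if x = [] then 0 else 1) + card (path_Des y)"
    and path_maj_append_lift: "path_maj (x @ North # y @ [East]) =
      path_maj x + length x + (path_maj y + Suc (length x) * card (path_Des y))"
proof -
  let ?K = "if x = [] then {} else {length x}" and ?s = "\<lambda>i. Suc (length x) + i"
  have disj: "(path_Des x \<union> ?K) \<inter> ?s ` path_Des y = {}" "path_Des x \<inter> ?K = {}"
    by (auto simp: path_Des_def)
  have inj: "inj_on ?s (path_Des y)" by (auto simp: inj_on_def)
  have "card (path_Des x \<union> ?K \<union> ?s ` path_Des y) = card (path_Des x) + card ?K + card (?s ` path_Des y)"
    using disj by (simp add: card_Un_disjoint)
  then show "card (path_Des (x @ North # y @ [East])) =
      card (path_Des x) + (if x = [] then 0 else 1) + card (path_Des y)"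
    unfolding path_Des_append_lift[OF x] card_image[OF inj] by simp
  have "\<Sum>(path_Des x \<union> ?K \<union> ?s ` path_Des y) = \<Sum>(path_Des x) + \<Sum>?K + \<Sum>(?s ` path_Des y)"
    using disj by (simp add: sum.union_disjoint)
  moreover have "\<Sum>(?s ` path_Des y) = \<Sum>(path_Des y) + Suc (length x) * card (path_Des y)"
    by (subst sum.reindex[OF inj]) (simp add: sum.distrib sum_Suc)
  ultimately show "path_maj (x @ North # y @ [East]) =
      path_maj x + length x + (path_maj y + Suc (length x) * card (path_Des y))"
    unfolding path_maj_def path_Des_append_lift[OF x] by simp
qed

subsection \<open>Area\<close>

text \<open>
  Each east step of a path contributes the boxes between it and the diagonal. The first argument
  is the excess of north over east steps before the word.
\<close>

fun east_area :: "int \<Rightarrow> step list \<Rightarrow> int" where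
  "east_area d [] = 0"
| "east_area d (North # w) = east_area (d + 1) w"
| "east_area d (East # w) = (d - 1) + east_area (d - 1) w"

lemma east_area_append:
  "east_area d (u @ v) =
    east_area d u + east_area (d + int (count_list u North) - int (count_list u East)) v"
  by (induction d u rule: east_area.induct) (auto simp: algebra_simps)

text \<open>Raising a path by one adds one box under each of its east steps.\<close>

lemma east_area_Suc: "east_area (d + 1) w = east_area d w + int (count_list w East)"
proof (induction d w rule: east_area.induct)
  case (3 d w)
  then show ?case using 3[symmetric] by simp
qed simp_all

lemma east_area_append_lift:
  assumes x: "x \<in> Dyck k" and y: "y \<in> Dyck m"
  shows "east_area 0 (x @ North # y @ [East]) = east_area 0 x + east_area 0 y + int m"
  using Dyck_count[OF x] Dyck_count[OF y] east_area_Suc[of 0 y] by (simp add: east_area_append)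

lemma east_area_eq_sum:
  "east_area 0 w = (\<Sum>p<length w. if w ! p = East
     then int (count_list (take p w) North) - int (count_list (take p w) East) - 1 else 0)"
proof (induction w rule: rev_induct)
  case (snoc s w)
  have "(\<Sum>p<length w. if (w @ [s]) ! p = East
     then int (count_list (take p (w @ [s])) North) - int (count_list (take p (w @ [s])) East) - 1 else 0)
    = east_area 0 w"
    unfolding snoc by (rule sum.cong) (auto simp: nth_append)
  then show ?case by (cases s) (simp_all add: east_area_append)
qed simp

lemma vertex_Suc:
  assumes "p < length D"
  shows "vertex D (Suc p) = vertex D p + (if D ! p = East then (1, 0) else (0, 1))"
  using assms by (cases "D ! p") (auto simp: vertex_def take_Suc_conv_app_nth)

lemma in_horizontal_segment_iff:
  "(x, y) \<in> closed_segment (a, b) (a + 1, b) \<longleftrightarrow> (a::real) \<le> x \<and> x \<le> a + 1 \<and> y = (b::real)"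
proof
  assume "(x, y) \<in> closed_segment (a, b) (a + 1, b)"
  then obtain u where "0 \<le> u" "u \<le> 1" "x = (1 - u) * a + u * (a + 1)" "y = (1 - u) * b + u * b"
    by (auto simp: in_segment)
  then show "a \<le> x \<and> x \<le> a + 1 \<and> y = b" by (auto simp: algebra_simps)
next
  assume *: "a \<le> x \<and> x \<le> a + 1 \<and> y = b"
  then show "(x, y) \<in> closed_segment (a, b) (a + 1, b)"
    unfolding in_segment by (intro exI[of _ "x - a"]) (auto simp: algebra_simps)
qed

lemma in_vertical_segmentD:
  assumes "(x, y) \<in> closed_segment (a, b) (a, c)"
  shows "x = (a::real)"
  using assms by (auto simp: in_segment algebra_simps)

text \<open>
  Over the open interval \<open>(i, i + 1)\<close> the path consists of a single horizontal segment. Testing a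
  box at its centre suffices, because the heights of the path are integers.
\<close>

lemma lies_below_unit_box_iff:
  "lies_below (unit_box i j) D \<longleftrightarrow> (\<exists>p<length D. D ! p = East \<and>
     int (count_list (take p D) East) = i \<and> j < int (count_list (take p D) North))"
proof
  assume below: "lies_below (unit_box i j) D"
  let ?x = "real_of_int i + 1/2" and ?y = "real_of_int j + 1/2"
  have "(?x, ?y) \<in> unit_box i j" by (simp add: unit_box_def)
  then obtain y' where y': "?y < y'" "(?x, y') \<in> path_curve D"
    using below unfolding lies_below_def by blast
  then obtain p where p: "p < length D" "(?x, y') \<in> closed_segment (vertex D p) (vertex D (Suc p))"
    unfolding path_curve_def by blast
  let ?e = "count_list (take p D) East" and ?h = "count_list (take p D) North"
  have v: "vertex D p = (real ?e, real ?h)" by (simp add: vertex_def)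
  have East: "D ! p = East"
  proof (rule ccontr)
    assume "D ! p \<noteq> East"
    then have "?x = real ?e"
      using p(2) unfolding vertex_Suc[OF p(1)] v by (auto dest: in_vertical_segmentD)
    then have "2 * i + 1 = 2 * int ?e" by linarith
    then show False by presburger
  qed
  then have "real ?e \<le> ?x \<and> ?x \<le> real ?e + 1 \<and> y' = real ?h"
    using p(2) unfolding vertex_Suc[OF p(1)] v by (simp add: in_horizontal_segment_iff)
  then have "int ?e = i" "j < int ?h" using y'(1) by linarith+
  with p(1) East show "\<exists>p<length D. D ! p = East \<and> int (count_list (take p D) East) = i \<and>
      j < int (count_list (take p D) North)" by blast
next
  assume "\<exists>p<length D. D ! p = East \<and> int (count_list (take p D) East) = i \<and>
      j < int (count_list (take p D) North)"
  then obtain p where p: "p < length D" "D ! p = East"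
    and i: "int (count_list (take p D) East) = i" and j: "j < int (count_list (take p D) North)" by blast
  let ?e = "count_list (take p D) East" and ?h = "count_list (take p D) North"
  have v: "vertex D p = (real ?e, real ?h)" by (simp add: vertex_def)
  have "\<exists>y'. y < y' \<and> (x, y') \<in> path_curve D" if xy: "(x, y) \<in> unit_box i j" for x y
  proof (intro exI conjI)
    show "y < real ?h" using xy j unfolding unit_box_def by auto
    have "(x, real ?h) \<in> closed_segment (vertex D p) (vertex D (Suc p))"
      using xy i p(2) unfolding vertex_Suc[OF p(1)] v
      by (auto simp: in_horizontal_segment_iff unit_box_def)
    then show "(x, real ?h) \<in> path_curve D" unfolding path_curve_def using p(1) by blast
  qed
  then show "lies_below (unit_box i j) D" unfolding lies_below_def by blast
qed

lemma area_eq_east_area: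
  assumes D: "D \<in> Dyck n"
  shows "int (area D) = east_area 0 D"
proof -
  define e h where "e p = count_list (take p D) East" and "h p = count_list (take p D) North" for p
  define P where "P = {p. p < length D \<and> D ! p = East}"
  have fin: "finite P" by (simp add: P_def)
  have above: "e p < h p" if "p \<in> P" for p
  proof -
    have "count_list (take (Suc p) D) East \<le> count_list (take (Suc p) D) North"
      by (rule Dyck_prefix[of _ "drop (Suc p) D"]) (use D in simp)
    then show ?thesis using that by (simp add: e_def h_def P_def take_Suc_conv_app_nth)
  qed
  have mono: "e p < e q" if "p \<in> P" "p < q" for p q
  proof -
    have "take q D = take (Suc p) D @ take (q - Suc p) (drop (Suc p) D)"
      using that take_add[of "Suc p" "q - Suc p" D] by simp
    then show ?thesis using that by (simp add: e_def P_def take_Suc_conv_app_nth)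
  qed
  have "{(i, j). lies_below (unit_box i j) D \<and> i < j}
      = (\<Union>p\<in>P. Pair (int (e p)) ` {int (e p)<..<int (h p)})"
    unfolding lies_below_unit_box_iff by (auto simp: P_def e_def h_def)
  then have "area D = card (\<Union>p\<in>P. Pair (int (e p)) ` {int (e p)<..<int (h p)})"
    by (simp add: area_def)
  also have "\<dots> = (\<Sum>p\<in>P. card (Pair (int (e p)) ` {int (e p)<..<int (h p)}))"
  proof (rule card_UN_disjoint)
    show "\<forall>p\<in>P. \<forall>q\<in>P. p \<noteq> q \<longrightarrow> Pair (int (e p)) ` {int (e p)<..<int (h p)} \<inter>
        Pair (int (e q)) ` {int (e q)<..<int (h q)} = {}"
      using mono by (fastforce simp: neq_iff)
  qed (use fin in auto)
  also have "\<dots> = (\<Sum>p\<in>P. h p - e p - 1)"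
    by (intro sum.cong refl) (subst card_image; auto simp: inj_on_def)
  finally have "int (area D) = (\<Sum>p\<in>P. int (h p - e p - 1))" by simp
  also have "\<dots> = (\<Sum>p\<in>P. int (h p) - int (e p) - 1)"
    using above by (intro sum.cong refl) (simp add: of_nat_diff Suc_leI)
  also have "\<dots> = east_area 0 D"
    unfolding east_area_eq_sum P_def e_def h_def
    by (simp add: sum.If_cases Int_def Collect_conj_eq[symmetric] lessThan_def)
  finally show ?thesis .
qed

lemma Dyck_of_statistics:
  "area (Dyck_of t) = shape_area t \<and> card (path_Des (Dyck_of t)) = shape_val t \<and>
   path_maj (Dyck_of t) = shape_maj t"
proof (induction t)
  case Leaf
  have "Dyck_of Leaf = []" by (simp add: Dyck_of_def)
  moreover have "path_Des [] = {}" by (auto simp: path_Des_def)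
  moreover have "area [] = 0" using area_eq_east_area[of "[]" 0] by (simp add: Dyck_iff)
  ultimately show ?case by (simp add: path_maj_def)
next
  case (Node l r)
  let ?x = "Dyck_of l" and ?y = "Dyck_of r"
  have node: "Dyck_of (Node l r) = ?x @ North # ?y @ [East]" by (simp add: Dyck_of_def)
  note x = Dyck_of_mem[of l] and y = Dyck_of_mem[of r]
  have Leaf_iff: "?x = [] \<longleftrightarrow> l = Leaf"
    using Dyck_length[OF x] by (cases l) auto
  have "int (area (Dyck_of (Node l r))) = int (area ?x) + int (area ?y) + int (size r)"
    using area_eq_east_area[OF Dyck_of_mem[of "Node l r"]] area_eq_east_area[OF x]
      area_eq_east_area[OF y] east_area_append_lift[OF x y] unfolding node by simp
  then have "area (Dyck_of (Node l r)) = shape_area (Node l r)" using Node.IH by simp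
  moreover have "card (path_Des (Dyck_of (Node l r))) = shape_val (Node l r)"
    unfolding node card_path_Des_append_lift[OF x] Leaf_iff using Node.IH by simp
  moreover have "path_maj (Dyck_of (Node l r)) = shape_maj (Node l r)"
    unfolding node path_maj_append_lift[OF x] Dyck_length[OF x] using Node.IH by simp
  ultimately show ?case by blast
qed

section \<open>The two bijections\<close>

lemma realises_statistics:
  assumes "realises t x"
  shows "perm_inv (size t) x = area (Dyck_of t)"
    and "int (size t) * (int (size t) - 1) - int (path_maj (Dyck_of t))
      = int (perm_maj (size t) x) + int (perm_imaj (size t) x)"
proof -
  let ?n = "size t"
  have x: "x permutes {1..?n}" using assms by (simp add: realises_def)
  show "perm_inv ?n x = area (Dyck_of t)"
    using assms Dyck_of_statistics[of t] by (simp add: realises_def)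
  have "\<Sum>(Asc ?n x) + \<Sum>(Asc ?n (inv x)) = path_maj (Dyck_of t)"
    using assms Dyck_of_statistics[of t] by (simp add: realises_def)
  moreover have "2 * (perm_maj ?n x + \<Sum>(Asc ?n x)) + 2 * (perm_imaj ?n x + \<Sum>(Asc ?n (inv x)))
      = 2 * (?n * (?n - 1))"
    using perm_maj_plus_Asc[OF x] perm_maj_plus_Asc[OF permutes_inv[OF x]]
    unfolding perm_imaj_def by simp
  ultimately have "perm_maj ?n x + perm_imaj ?n x + path_maj (Dyck_of t) = ?n * (?n - 1)" by simp
  moreover have "int (?n * (?n - 1)) = int ?n * (int ?n - 1)" by (cases ?n) (simp_all add: algebra_simps)
  ultimately show "int ?n * (int ?n - 1) - int (path_maj (Dyck_of t))
      = int (perm_maj ?n x) + int (perm_imaj ?n x)" by linarith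
qed

theorem theorem1p2:
  fixes n :: nat
  assumes "n \<ge> 1"
  shows "\<exists>\<phi> \<psi>. bij_betw \<phi> (Dyck n) (NC n) \<and> bij_betw \<psi> (Dyck n) (Sort n) \<and>
    (\<forall>D\<in>Dyck n.
       area D = perm_inv n (\<phi> D) \<and>
       area D = perm_inv n (\<psi> D) \<and>
       int n * (int n - 1) - int (path_maj D)
         = int (perm_maj n (\<phi> D)) + int (perm_imaj n (\<phi> D)) \<and>
       int n * (int n - 1) - int (path_maj D)
         = int (perm_maj n (\<psi> D)) + int (perm_imaj n (\<psi> D)))"
proof -
  let ?T = "{t. size t = n}"
  define tree where "tree = inv_into ?T Dyck_of"
  have tree: "bij_betw tree (Dyck n) ?T"
    unfolding tree_def by (rule bij_betw_inv_into[OF bij_betw_Dyck_of])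
  have Dyck_tree: "Dyck_of (tree D) = D" if "D \<in> Dyck n" for D
    unfolding tree_def using bij_betw_inv_into_right[OF bij_betw_Dyck_of that] .
  have size: "size (tree D) = n" if "D \<in> Dyck n" for D
    using bij_betwE[OF tree] that by blast
  show ?thesis
  proof (intro exI conjI ballI)
    show "bij_betw (NC_of \<circ> tree) (Dyck n) (NC n)"
      by (rule bij_betw_trans[OF tree bij_betw_NC_of])
    show "bij_betw (Sort_of \<circ> tree) (Dyck n) (Sort n)"
      by (rule bij_betw_trans[OF tree bij_betw_Sort_of])
  next
    fix D assume D: "D \<in> Dyck n"
    note NC = realises_statistics[OF realises_NC_of[of "tree D"], unfolded Dyck_tree[OF D] size[OF D]]
    note Sort = realises_statistics[OF realises_Sort_of[of "tree D"], unfolded Dyck_tree[OF D] size[OF D]]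
    show "area D = perm_inv n ((NC_of \<circ> tree) D)" "area D = perm_inv n ((Sort_of \<circ> tree) D)"
      using NC(1) Sort(1) by simp_all
    show "int n * (int n - 1) - int (path_maj D)
        = int (perm_maj n ((NC_of \<circ> tree) D)) + int (perm_imaj n ((NC_of \<circ> tree) D))"
      "int n * (int n - 1) - int (path_maj D)
        = int (perm_maj n ((Sort_of \<circ> tree) D)) + int (perm_imaj n ((Sort_of \<circ> tree) D))"
      using NC(2) Sort(2) by simp_all
  qed
qed

end
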